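(* Consider a multi-agent system of $N\ge 2$ identical agents $\dot x_i=Ax_i+Bu_i+Ed_i$, $y_i=C_1x_i+D_1d_i$, $z_i=C_2x_i+D_2u_i$, $i=1,\dots,N$, with $(A,B)$ stabilizable and $(C_1,A)$ detectable, over a connected simple undirected weighted graph whose Laplacian matrix $L$ has eigenvalues $0=\lambda_1<\lambda_2\le\dots\le\lambda_N$. Let $\gamma>0$. Assume that $D_1E^\top=0$, $D_2^\top C_2=0$, $D_1D_1^\top=I_r$ and $D_2^\top D_2=I_m$. Let $Q>0$ satisfy $$AQ+QA^\top-QC_1^\top C_1Q+EE^\top<0.$$ Let $c$ be any real number such that $0<c<\frac{2}{\lambda_N^2}$. Two cases are distinguished: (i) If $\frac{2}{\lambda_2^2+\lambda_2\lambda_N+\lambda_N^2}\le c<\frac{2}{\lambda_N^2}$, then there exists $P>0$ satisfying $$A^\top P+PA+(c^2\lambda_N^3-2c\lambda_N)PBB^\top P+\lambda_NC_2^\top C_2<0.\qquad(\ast)$$ (ii) If $0<c<\frac{2}{\lambda_2^2+\lambda_2\lambda_N+\lambda_N^2}$, then there exists $P>0$ satisfying $$A^\top P+PA+(c^2\lambda_2^3-2c\lambda_2)PBB^\top P+\lambda_NC_2^\top C_2<0.\qquad(\ast\ast)$$ In both cases, if a matrix $P>0$ satisfying the corresponding inequality ($(\ast)$ in case (i), $(\ast\ast)$ in case (ii)) and the matrix $Q$ in addition satisfy $$\operatorname{tr}\left(C_1QPQC_1^\top\right)+\lambda_N\operatorname{tr}\left(C_2QC_2^\top\right)<\frac{\gamma}{N-1},$$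 then the distributed dynamic protocol with local gains $F:=-cB^\top P$ and $G:=QC_1^\top$ synchronizes the network and it is suboptimal, i.e. $J(F,G)<\gamma$.
   Context: For symmetric $M$, $M>0$ (resp. $M<0$) means positive (resp. negative) definite (matrices written $>0$ are real symmetric); $\otimes$ is the Kronecker product. Agents: $x_i\in\mathbb{R}^n$, $u_i\in\mathbb{R}^m$, $d_i\in\mathbb{R}^q$, $y_i\in\mathbb{R}^r$, $z_i\in\mathbb{R}^p$; $A,B,E,C_1,D_1,C_2,D_2$ are real matrices of compatible dimensions. Graph: node set $\{1,\dots,N\}$, symmetric adjacency matrix $\mathcal{A}=[a_{ij}]$ with $a_{ij}\ge0$, $a_{ii}=0$, connected; $L=\mathcal{D}-\mathcal{A}$ with $\mathcal{D}$ the diagonal matrix with entries $\sum_ja_{ij}$. Let $K$ be the number of unordered pairs $\{i,j\}$ with $a_{ij}>0$. The incidence matrix $R\in\mathbb{R}^{N\times K}$ has one column per such pair $\{i,j\}$, whose $i$th and $j$th entries are $+1$ and $-1$ in some (arbitrary) order, all other entries being $0$; $W$ is the $K\times K$ diagonal matrix of the corresponding edge weights $a_{ij}$. One has $L=RWR^\top$. Protocol with local gains $F\in\mathbb{R}^{m\times n}$, $G\in\mathbb{R}^{n\times r}$: $$\dot w_i=Aw_i+B\sum_{j=1}^Na_{ij}(u_i-u_j)+G\Big(\sum_{j=1}^Na_{ij}(y_i-y_j)-C_1w_i\Big),\quad u_i=Fw_i,\quad i=1,\dots,N.$$ With $\mathbf{x}=(x_1^\top,\dots,x_N^\top)^\top$,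 and similarly $\mathbf{w},\mathbf{d},\mathbf{z}$, and with the output $\boldsymbol\zeta=(W^{1/2}R^\top\otimes I_p)\mathbf{z}$, the controlled network is $$\begin{pmatrix}\dot{\mathbf{x}}\\ \dot{\mathbf{w}}\end{pmatrix}=A_e\begin{pmatrix}\mathbf{x}\\ \mathbf{w}\end{pmatrix}+E_e\mathbf{d},\quad\boldsymbol\zeta=C_e\begin{pmatrix}\mathbf{x}\\ \mathbf{w}\end{pmatrix},$$ $$A_e=\begin{pmatrix}I_N\otimes A&I_N\otimes BF\\ L\otimes GC_1&I_N\otimes(A-GC_1)+L\otimes BF\end{pmatrix},\quad E_e=\begin{pmatrix}I_N\otimes E\\ L\otimes GD_1\end{pmatrix},$$ $$C_e=\begin{pmatrix}W^{1/2}R^\top\otimes C_2&W^{1/2}R^\top\otimes D_2F\end{pmatrix}.$$ The protocol synchronizes the network if, whenever $\mathbf{d}=0$, for all initial states and all $i,j$ we have $x_i(t)-x_j(t)\to0$ and $w_i(t)-w_j(t)\to0$ as $t\to\infty$. The global $\mathcal{H}_2$ cost is $$J(F,G)=\int_0^\infty\operatorname{tr}\left[T_{F,G}^\top(t)T_{F,G}(t)\right]dt,\qquad T_{F,G}(t)=C_ee^{A_et}E_e.$$ *)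

theory Defs
  imports "HOL-Analysis.Analysis"
begin

section \<open>Matrices\<close>

definition pos_def :: "real^'n^'n \<Rightarrow> bool" where
  "pos_def M \<longleftrightarrow> transpose M = M \<and> (\<forall>x. x \<noteq> 0 \<longrightarrow> 0 < x \<bullet> (M *v x))"

definition neg_def :: "real^'n^'n \<Rightarrow> bool" where
  "neg_def M \<longleftrightarrow> transpose M = M \<and> (\<forall>x. x \<noteq> 0 \<longrightarrow> x \<bullet> (M *v x) < 0)"

definition diag_mat :: "('k \<Rightarrow> real) \<Rightarrow> real^'k^'k" where
  "diag_mat v = (\<chi> i j. if i = j then v i else 0)"

definition kron :: "real^'b^'a \<Rightarrow> real^'d^'c \<Rightarrow> real^('b \<times> 'd)^('a \<times> 'c)" (infixl "\<otimes>\<^sub>K" 75) where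
  "X \<otimes>\<^sub>K Y = (\<chi> i j. X $ fst i $ fst j * Y $ snd i $ snd j)"

definition hcat :: "real^'b^'a \<Rightarrow> real^'c^'a \<Rightarrow> real^('b + 'c)^'a" where
  "hcat X Y = (\<chi> i j. case j of Inl k \<Rightarrow> X $ i $ k | Inr k \<Rightarrow> Y $ i $ k)"

definition vcat :: "real^'b^'a \<Rightarrow> real^'b^'c \<Rightarrow> real^'b^('a + 'c)" where
  "vcat X Y = (\<chi> i. case i of Inl k \<Rightarrow> X $ k | Inr k \<Rightarrow> Y $ k)"

definition mat_power :: "real^'n^'n \<Rightarrow> nat \<Rightarrow> real^'n^'n" where
  "mat_power M k = (((**) M) ^^ k) (mat 1)"

text \<open>The library's \<open>exp\<close> is not available on \<^typ>\<open>real^'n^'n\<close>: the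
  multiplication \<open>*\<close> of that type is the entrywise one.\<close>

definition mat_exp :: "real^'n^'n \<Rightarrow> real^'n^'n" where
  "mat_exp M = (\<Sum>k. mat_power M k /\<^sub>R fact k)"

definition ordered_eigenvalues :: "real^'n^'n \<Rightarrow> (nat \<Rightarrow> real) \<Rightarrow> bool" where
  \<comment> \<open>\<open>ev 1 \<le> \<dots> \<le> ev n\<close> are the roots of the characteristic polynomial, with multiplicity\<close>
  "ordered_eigenvalues M ev \<longleftrightarrow>
     mono_on {1..CARD('n)} ev \<and> (\<forall>s. det (mat s - M) = (\<Prod>i=1..CARD('n). s - ev i))"

section \<open>Stabilizability and detectability\<close>

definition complex_mat :: "real^'n^'m \<Rightarrow> complex^'n^'m" where
  "complex_mat M = (\<chi> i j. complex_of_real (M $ i $ j))"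

definition hurwitz :: "real^'n^'n \<Rightarrow> bool" where
  "hurwitz M \<longleftrightarrow> (\<forall>s v. v \<noteq> 0 \<and> complex_mat M *v v = s *s v \<longrightarrow> Re s < 0)"

definition stabilizable :: "real^'n^'n \<Rightarrow> real^'m^'n \<Rightarrow> bool" where
  "stabilizable A B \<longleftrightarrow> (\<exists>F :: real^'n^'m. hurwitz (A + B ** F))"

definition detectable :: "real^'n^'r \<Rightarrow> real^'n^'n \<Rightarrow> bool" where
  "detectable C A \<longleftrightarrow> (\<exists>G :: real^'r^'n. hurwitz (A + G ** C))"

section \<open>Weighted graphs\<close>

definition weighted_graph :: "real^'N^'N \<Rightarrow> bool" where
  "weighted_graph Adj \<longleftrightarrow>
     (\<forall>i j. Adj $ i $ j = Adj $ j $ i \<and> 0 \<le> Adj $ i $ j) \<and> (\<forall>i. Adj $ i $ i = 0)"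

definition connected_graph :: "real^'N^'N \<Rightarrow> bool" where
  "connected_graph Adj \<longleftrightarrow> (\<forall>i j. (i, j) \<in> {(i, j). 0 < Adj $ i $ j}\<^sup>*)"

definition laplacian :: "real^'N^'N \<Rightarrow> real^'N^'N" where
  "laplacian Adj = diag_mat (\<lambda>i. \<Sum>j\<in>UNIV. Adj $ i $ j) - Adj"

text \<open>An edge enumeration lists every unordered pair \<open>{i, j}\<close> of positive weight exactly once, as
  an ordered pair; the order encodes the arbitrary choice of signs in the incidence matrix.
  In particular the index type \<open>'k\<close> has as many elements as there are edges.\<close>

definition edge_enumeration :: "real^'N^'N \<Rightarrow> ('k \<Rightarrow> 'N \<times> 'N) \<Rightarrow> bool" where
  "edge_enumeration Adj e \<longleftrightarrow>
     bij_betw (\<lambda>k. {fst (e k), snd (e k)}) UNIV {{i, j} | i j. 0 < Adj $ i $ j}"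

definition incidence :: "('k \<Rightarrow> 'N \<times> 'N) \<Rightarrow> real^'k^'N" where
  "incidence e = (\<chi> i k. if i = fst (e k) then 1 else if i = snd (e k) then - 1 else 0)"

definition edge_weight :: "real^'N^'N \<Rightarrow> ('k \<Rightarrow> 'N \<times> 'N) \<Rightarrow> 'k \<Rightarrow> real" where
  "edge_weight Adj e k = Adj $ fst (e k) $ snd (e k)"

section \<open>The controlled network\<close>

definition closed_loop ::
  "real^'N^'N \<Rightarrow> real^'n^'n \<Rightarrow> real^'m^'n \<Rightarrow> real^'q^'n \<Rightarrow> real^'n^'r \<Rightarrow> real^'q^'r \<Rightarrow>
   real^'n^'m \<Rightarrow> real^'r^'n \<Rightarrow> ('N \<Rightarrow> real \<Rightarrow> real^'q) \<Rightarrow>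
   ('N \<Rightarrow> real \<Rightarrow> real^'n) \<Rightarrow> ('N \<Rightarrow> real \<Rightarrow> real^'n) \<Rightarrow> bool" where
  "closed_loop Adj A B E C1 D1 F G d x w \<longleftrightarrow>
     (let u = (\<lambda>i t. F *v w i t); y = (\<lambda>i t. C1 *v x i t + D1 *v d i t) in
      \<forall>i. \<forall>t\<ge>0.
        (x i has_vector_derivative (A *v x i t + B *v u i t + E *v d i t)) (at t within {0..}) \<and>
        (w i has_vector_derivative
           (A *v w i t + B *v (\<Sum>j\<in>UNIV. Adj $ i $ j *\<^sub>R (u i t - u j t))
            + G *v ((\<Sum>j\<in>UNIV. Adj $ i $ j *\<^sub>R (y i t - y j t)) - C1 *v w i t)))
          (at t within {0..}))"

definition synchronizes ::
  "real^'N^'N \<Rightarrow> real^'n^'n \<Rightarrow> real^'m^'n \<Rightarrow> real^'q^'n \<Rightarrow> real^'n^'r \<Rightarrow> real^'q^'r \<Rightarrow>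
   real^'n^'m \<Rightarrow> real^'r^'n \<Rightarrow> bool" where
  "synchronizes Adj A B E C1 D1 F G \<longleftrightarrow>
     (\<forall>x w. closed_loop Adj A B E C1 D1 F G (\<lambda>i t. 0) x w \<longrightarrow>
        (\<forall>i j. ((\<lambda>t. x i t - x j t) \<longlongrightarrow> 0) at_top \<and> ((\<lambda>t. w i t - w j t) \<longlongrightarrow> 0) at_top))"

definition net_A ::
  "real^'N^'N \<Rightarrow> real^'n^'n \<Rightarrow> real^'m^'n \<Rightarrow> real^'n^'r \<Rightarrow> real^'n^'m \<Rightarrow> real^'r^'n \<Rightarrow>
   real^(('N \<times> 'n) + ('N \<times> 'n))^(('N \<times> 'n) + ('N \<times> 'n))" where
  "net_A Adj A B C1 F G =
     vcat (hcat (mat 1 \<otimes>\<^sub>K A) (mat 1 \<otimes>\<^sub>K (B ** F)))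
          (hcat (laplacian Adj \<otimes>\<^sub>K (G ** C1))
                (mat 1 \<otimes>\<^sub>K (A - G ** C1) + laplacian Adj \<otimes>\<^sub>K (B ** F)))"

definition net_E ::
  "real^'N^'N \<Rightarrow> real^'q^'n \<Rightarrow> real^'q^'r \<Rightarrow> real^'r^'n \<Rightarrow>
   real^('N \<times> 'q)^(('N \<times> 'n) + ('N \<times> 'n))" where
  "net_E Adj E D1 G = vcat (mat 1 \<otimes>\<^sub>K E) (laplacian Adj \<otimes>\<^sub>K (G ** D1))"

text \<open>The matrix \<open>W\<^sup>1\<^sup>/\<^sup>2 R\<^sup>T\<close>.\<close>

definition output_weight :: "real^'N^'N \<Rightarrow> ('k::finite \<Rightarrow> 'N \<times> 'N) \<Rightarrow> real^'N^'k" where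
  "output_weight Adj e = diag_mat (\<lambda>k. sqrt (edge_weight Adj e k)) ** transpose (incidence e)"

definition net_C ::
  "real^'N^'N \<Rightarrow> ('k::finite \<Rightarrow> 'N \<times> 'N) \<Rightarrow> real^'n^'p \<Rightarrow> real^'m^'p \<Rightarrow> real^'n^'m \<Rightarrow>
   real^(('N \<times> 'n) + ('N \<times> 'n))^('k \<times> 'p)" where
  "net_C Adj e C2 D2 F =
     hcat (output_weight Adj e \<otimes>\<^sub>K C2) (output_weight Adj e \<otimes>\<^sub>K (D2 ** F))"

definition impulse_response ::
  "real^'N^'N \<Rightarrow> ('k::finite \<Rightarrow> 'N \<times> 'N) \<Rightarrow> real^'n^'n \<Rightarrow> real^'m^'n \<Rightarrow> real^'q^'n \<Rightarrow> real^'n^'r \<Rightarrow>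
   real^'q^'r \<Rightarrow> real^'n^'p \<Rightarrow> real^'m^'p \<Rightarrow> real^'n^'m \<Rightarrow> real^'r^'n \<Rightarrow> real \<Rightarrow>
   real^('N \<times> 'q)^('k \<times> 'p)" where
  "impulse_response Adj e A B E C1 D1 C2 D2 F G t =
     net_C Adj e C2 D2 F ** mat_exp (t *\<^sub>R net_A Adj A B C1 F G) ** net_E Adj E D1 G"

text \<open>The cost takes values in \<^typ>\<open>ennreal\<close>, so a divergent integral is \<open>\<infinity>\<close> (rather than the
  default value \<open>0\<close> of a non-existing real integral) and never lies below a finite bound.\<close>

definition H2_cost ::
  "real^'N^'N \<Rightarrow> ('k::finite \<Rightarrow> 'N \<times> 'N) \<Rightarrow> real^'n^'n \<Rightarrow> real^'m^'n \<Rightarrow> real^'q^'n \<Rightarrow> real^'n^'r \<Rightarrow>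
   real^'q^'r \<Rightarrow> real^'n^'p \<Rightarrow> real^'m^'p \<Rightarrow> real^'n^'m \<Rightarrow> real^'r^'n \<Rightarrow> ennreal" where
  "H2_cost Adj e A B E C1 D1 C2 D2 F G =
     (\<integral>\<^sup>+ t\<in>{0..}. ennreal (trace
        (transpose (impulse_response Adj e A B E C1 D1 C2 D2 F G t)
         ** impulse_response Adj e A B E C1 D1 C2 D2 F G t)) \<partial>lborel)"

section \<open>Agreement of the agent-wise and the compact description\<close>

lemma laplacian_eq_incidence:
  fixes Adj :: "real^'N^'N" and e :: "'k::finite \<Rightarrow> 'N \<times> 'N"
  assumes "weighted_graph Adj" "edge_enumeration Adj e"
  shows "laplacian Adj = incidence e ** diag_mat (edge_weight Adj e) ** transpose (incidence e)"
proof -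
  define pr where "pr k = {fst (e k), snd (e k)}" for k
  define S where "S = {{i, j} | i j. 0 < Adj $ i $ j}"
  have sym: "Adj $ i $ j = Adj $ j $ i" and nonneg: "0 \<le> Adj $ i $ j" and diag: "Adj $ i $ i = 0" for i j
    using assms(1) by (auto simp: weighted_graph_def)
  have bij: "bij_betw pr UNIV S"
    using assms(2) by (simp add: edge_enumeration_def pr_def[abs_def] S_def)
  have w: "edge_weight Adj e k = Adj $ i $ j" if "pr k = {i, j}" for i j k
    using that sym by (auto simp: pr_def edge_weight_def doubleton_eq_iff)
  have ne: "fst (e k) \<noteq> snd (e k)" for k
  proof -
    have "pr k \<in> S"
      using bij by (auto simp: bij_betw_def)
    then show ?thesis
      by (auto simp: S_def pr_def doubleton_eq_iff diag)
  qed
  have key: "(\<Sum>k\<in>UNIV. if pr k = {i, j} then edge_weight Adj e k else 0) = Adj $ i $ j" for i j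
  proof (cases "0 < Adj $ i $ j")
    case True
    then have "{i, j} \<in> S"
      by (auto simp: S_def)
    then obtain k where k: "pr k = {i, j}"
      using bij by (auto simp: bij_betw_def image_iff)
    then have "pr k' = {i, j} \<longleftrightarrow> k' = k" for k'
      using bij by (metis bij_betw_def injD)
    then show ?thesis
      using w[OF k] by simp
  next
    case False
    have "pr k \<noteq> {i, j}" for k
      using bij False sym[of i j] unfolding bij_betw_def S_def
      by (smt (verit) doubleton_eq_iff mem_Collect_eq rangeI)
    then show ?thesis
      using False nonneg[of i j] by simp
  qed
  have off: "(\<Sum>k\<in>UNIV. incidence e $ i $ k * edge_weight Adj e k * incidence e $ j $ k) = - Adj $ i $ j"
    if "i \<noteq> j" for i j
  proof -
    have "incidence e $ i $ k * edge_weight Adj e k * incidence e $ j $ k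
        = - (if pr k = {i, j} then edge_weight Adj e k else 0)" for k
      using that ne[of k] by (auto simp: incidence_def pr_def doubleton_eq_iff)
    then show ?thesis
      by (simp add: sum_negf key)
  qed
  have on: "(\<Sum>k\<in>UNIV. incidence e $ i $ k * edge_weight Adj e k * incidence e $ i $ k)
      = (\<Sum>j\<in>UNIV. Adj $ i $ j)" for i
  proof -
    have "incidence e $ i $ k * edge_weight Adj e k * incidence e $ i $ k
        = (\<Sum>j\<in>UNIV. if pr k = {i, j} then edge_weight Adj e k else 0)" for k
    proof -
      have "pr k = {i, j} \<longleftrightarrow>
          i = fst (e k) \<and> j = snd (e k) \<or> i = snd (e k) \<and> j = fst (e k)" for j
        by (auto simp: pr_def doubleton_eq_iff)
      then show ?thesis
        using ne[of k] by (cases "i = fst (e k)"; cases "i = snd (e k)") (auto simp: incidence_def)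
    qed
    then have "(\<Sum>k\<in>UNIV. incidence e $ i $ k * edge_weight Adj e k * incidence e $ i $ k)
        = (\<Sum>j\<in>UNIV. \<Sum>k\<in>UNIV. if pr k = {i, j} then edge_weight Adj e k else 0)"
      by (simp only:) (rule sum.swap)
    then show ?thesis
      by (simp add: key)
  qed
  have "(incidence e ** diag_mat (edge_weight Adj e) ** transpose (incidence e)) $ i $ j
      = (\<Sum>k\<in>UNIV. incidence e $ i $ k * edge_weight Adj e k * incidence e $ j $ k)" for i j
    by (simp add: matrix_matrix_mult_def diag_mat_def transpose_def if_distrib cong: if_cong)
  then show ?thesis
    using on off by (auto simp: vec_eq_iff laplacian_def diag_mat_def diag)
qed

definition stack1 :: "('N::finite \<Rightarrow> real^'n) \<Rightarrow> real^('N \<times> 'n)" where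
  "stack1 x = (\<chi> i. x (fst i) $ snd i)"

definition stack2 :: "real^'a \<Rightarrow> real^'b \<Rightarrow> real^('a + 'b)" where
  "stack2 x w = (\<chi> i. case i of Inl k \<Rightarrow> x $ k | Inr k \<Rightarrow> w $ k)"

lemma hcat_mult_stack2: "hcat X Y *v stack2 x w = X *v x + Y *v w"
  by (simp add: hcat_def stack2_def matrix_vector_mult_def vec_eq_iff sum.Plus
       flip: UNIV_Plus_UNIV)

lemma vcat_mult: "vcat X Y *v v = stack2 (X *v v) (Y *v v)"
  by (auto simp: vcat_def stack2_def matrix_vector_mult_def vec_eq_iff split: sum.split)

lemma kron_mult_stack1:
  fixes X :: "real^'b^'a" and Y :: "real^'d^'c"
  shows "(X \<otimes>\<^sub>K Y) *v stack1 x = stack1 (\<lambda>i. \<Sum>j\<in>UNIV. X $ i $ j *\<^sub>R (Y *v x j))"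
  by (simp add: kron_def stack1_def matrix_vector_mult_def vec_eq_iff sum_distrib_left
       sum.cartesian_product mult.assoc flip: UNIV_Times_UNIV) (simp add: case_prod_beta)

lemma has_vector_derivative_vec_iff:
  fixes f :: "real \<Rightarrow> real^'n"
  shows "(f has_vector_derivative D) (at t within S) \<longleftrightarrow>
    (\<forall>i. ((\<lambda>t. f t $ i) has_vector_derivative D $ i) (at t within S))"
  unfolding has_vector_derivative_def
  by (subst has_derivative_componentwise_within)
     (auto simp: Basis_vec_def inner_axis)

lemma laplacian_sum:
  fixes v :: "'N::finite \<Rightarrow> real^'n"
  shows "(\<Sum>j\<in>UNIV. laplacian Adj $ i $ j *\<^sub>R v j) = (\<Sum>j\<in>UNIV. Adj $ i $ j *\<^sub>R (v i - v j))"
proof -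
  have "(\<Sum>j\<in>UNIV. laplacian Adj $ i $ j *\<^sub>R v j)
      = (\<Sum>j\<in>UNIV. (if i = j then (\<Sum>k\<in>UNIV. Adj $ i $ k) *\<^sub>R v j else 0) - Adj $ i $ j *\<^sub>R v j)"
    by (intro sum.cong) (auto simp: laplacian_def diag_mat_def algebra_simps)
  then show ?thesis
    by (simp add: sum_subtractf scaleR_diff_right scaleR_sum_left)
qed

lemma kron_id_mult_stack1:
  fixes v :: "'N::finite \<Rightarrow> real^'n"
  shows "(mat 1 \<otimes>\<^sub>K M) *v stack1 v = stack1 (\<lambda>i. M *v v i)"
proof -
  have "(\<Sum>j\<in>UNIV. (mat 1 :: real^'N^'N) $ i $ j *\<^sub>R (M *v v j))
      = (\<Sum>j\<in>UNIV. if i = j then M *v v j else 0)" for i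
    by (intro sum.cong) (auto simp: mat_def)
  then show ?thesis
    by (simp add: kron_mult_stack1)
qed

lemma kron_laplacian_mult_stack1:
  "(laplacian Adj \<otimes>\<^sub>K M) *v stack1 v
    = stack1 (\<lambda>i. M *v (\<Sum>j\<in>UNIV. Adj $ i $ j *\<^sub>R (v i - v j)))"
  by (simp add: kron_mult_stack1 laplacian_sum linear_sum[OF matrix_vector_mul_linear]
      matrix_vector_mult_scaleR matrix_vector_mult_diff_distrib)

lemma stack1_add: "stack1 f + stack1 g = stack1 (\<lambda>i. f i + g i)"
  by (simp add: stack1_def vec_eq_iff)

lemma stack2_add: "stack2 a b + stack2 c d = stack2 (a + c) (b + d)"
  by (auto simp: stack2_def vec_eq_iff split: sum.split)

lemma has_vector_derivative_stack:
  "((\<lambda>t. stack2 (stack1 (\<lambda>i. x i t)) (stack1 (\<lambda>i. w i t))) has_vector_derivative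
      stack2 (stack1 x') (stack1 w')) (at t within S) \<longleftrightarrow>
    (\<forall>i. (x i has_vector_derivative x' i) (at t within S) \<and>
         (w i has_vector_derivative w' i) (at t within S))"
  unfolding has_vector_derivative_vec_iff split_sum_all
  by (simp add: stack2_def stack1_def all_conj_distrib)

lemma closed_loop_iff_compact:
  "closed_loop Adj A B E C1 D1 F G d x w \<longleftrightarrow>
    (\<forall>t\<ge>0. ((\<lambda>t. stack2 (stack1 (\<lambda>i. x i t)) (stack1 (\<lambda>i. w i t))) has_vector_derivative
       net_A Adj A B C1 F G *v stack2 (stack1 (\<lambda>i. x i t)) (stack1 (\<lambda>i. w i t))
       + net_E Adj E D1 G *v stack1 (\<lambda>i. d i t)) (at t within {0..}))"
proof -
  have rhs: "net_A Adj A B C1 F G *v stack2 (stack1 (\<lambda>i. x i t)) (stack1 (\<lambda>i. w i t))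
       + net_E Adj E D1 G *v stack1 (\<lambda>i. d i t)
     = stack2 (stack1 (\<lambda>i. A *v x i t + B *v (F *v w i t) + E *v d i t))
         (stack1 (\<lambda>i. A *v w i t
            + B *v (\<Sum>j\<in>UNIV. Adj $ i $ j *\<^sub>R (F *v w i t - F *v w j t))
            + G *v ((\<Sum>j\<in>UNIV. Adj $ i $ j *\<^sub>R
                (C1 *v x i t + D1 *v d i t - (C1 *v x j t + D1 *v d j t))) - C1 *v w i t)))"
    (is "?l = ?r") for t
  proof -
    have F: "(\<Sum>j\<in>UNIV. Adj $ i $ j *\<^sub>R (F *v w i t - F *v w j t))
        = F *v (\<Sum>j\<in>UNIV. Adj $ i $ j *\<^sub>R (w i t - w j t))" for i
      by (simp add: linear_sum[OF matrix_vector_mul_linear] matrix_vector_mult_scaleR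
          matrix_vector_mult_diff_distrib)
    have y: "(\<Sum>j\<in>UNIV. Adj $ i $ j *\<^sub>R
          (C1 *v x i t + D1 *v d i t - (C1 *v x j t + D1 *v d j t)))
        = C1 *v (\<Sum>j\<in>UNIV. Adj $ i $ j *\<^sub>R (x i t - x j t))
        + D1 *v (\<Sum>j\<in>UNIV. Adj $ i $ j *\<^sub>R (d i t - d j t))" for i
      by (simp add: linear_sum[OF matrix_vector_mul_linear] matrix_vector_mult_scaleR
          matrix_vector_mult_diff_distrib sum.distrib[symmetric] scaleR_add_right[symmetric]
          add_diff_add)
    show ?thesis
      unfolding F y net_A_def net_E_def vcat_mult hcat_mult_stack2 matrix_vector_mult_add_rdistrib
        kron_id_mult_stack1 kron_laplacian_mult_stack1 stack1_add stack2_add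
      by (simp add: matrix_vector_mult_diff_rdistrib matrix_vector_right_distrib
          matrix_vector_mult_diff_distrib matrix_vector_mul_assoc[symmetric] algebra_simps)
  qed
  show ?thesis
    unfolding rhs has_vector_derivative_stack closed_loop_def Let_def by blast
qed

lemma net_C_output:
  "net_C Adj e C2 D2 F *v stack2 (stack1 x) (stack1 w) =
    (output_weight Adj e \<otimes>\<^sub>K mat 1) *v stack1 (\<lambda>i. C2 *v x i + D2 *v (F *v w i))"
  by (simp add: net_C_def hcat_mult_stack2 kron_mult_stack1)
     (simp add: stack1_def vec_eq_iff sum.distrib algebra_simps matrix_vector_mul_assoc)

end

theory Submission
  imports Defs "HOL-Computational_Algebra.Fundamental_Theorem_Algebra"
begin

text \<open>An eigenvector of the Laplacian with eigenvalue \<open>l > 0\<close> cuts out an invariant subsystem. In the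
  coordinates \<open>h = x - w / l\<close> and \<open>y = w / l\<close> it becomes a cascade: \<open>h\<close> obeys the observer
  dynamics \<open>A - G C\<^sub>1\<close> and drives \<open>y\<close>, which obeys the state feedback dynamics \<open>A + l B F\<close>. The
  inequality for \<open>Q\<close> makes the observer stable. Since \<open>c\<^sup>2 l\<^sup>3 - 2 c l\<close> is maximal at an end
  point of \<open>[\<lambda>\<^sub>2, \<lambda>\<^sub>N]\<close>, the inequality for \<open>P\<close> makes all feedback loops stable, which gives
  synchronization.

  For the cost of a mode, a row \<open>(p, r)\<close> of the impulse response in these coordinates evolves by the transposed dynamics, and
  \<open>D\<^sub>1 E\<^sup>T = 0\<close>, \<open>D\<^sub>1 D\<^sub>1\<^sup>T = I\<close> and \<open>G = Q C\<^sub>1\<^sup>T\<close> make the derivative of \<open>p \<bullet> Q p\<close> plus the output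
  energy at most \<open>\<bar>G\<^sup>T r\<bar>\<^sup>2\<close>. Summed over all rows, this bound is a Frobenius norm, so that it can be
  read column-wise, where it is the output energy of the feedback loop started at the columns of
  \<open>G\<close>; that energy is dissipated by \<open>P\<close> and totals at most \<open>tr (G\<^sup>T P G)\<close>. The mode thus costs at most
  \<open>l tr (C\<^sub>2 Q C\<^sub>2\<^sup>T) + tr (C\<^sub>1 Q P Q C\<^sub>1\<^sup>T)\<close>, and the mode with eigenvalue \<open>0\<close> costs nothing.\<close>

section \<open>Matrix algebra\<close>

declare transpose_matrix_vector [simp del]

lemma transpose_add: "transpose (A + B) = transpose A + transpose B"
  by (simp add: transpose_def vec_eq_iff)

lemma transpose_diff: "transpose (A - B) = transpose A - transpose B"
  by (simp add: transpose_def vec_eq_iff)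

lemma matrix_add_rdistrib: "(A + B) ** C = A ** C + B ** (C :: real^'n^'m)"
  by (simp add: matrix_matrix_mult_def vec_eq_iff distrib_right sum.distrib)

lemmas matrix_scaleR_left = scalar_matrix_assoc[symmetric]

lemma matrix_scaleR_right: "A ** (r *\<^sub>R B) = r *\<^sub>R (A ** (B :: real^'n^'m))"
  by (simp add: matrix_scalar_ac matrix_scaleR_left)

lemmas scaleR_matrix_vector = scaleR_matrix_vector_assoc[symmetric]

lemma inner_transpose_mult: "x \<bullet> (transpose A *v y) = (A *v x) \<bullet> (y :: real^'n)"
  by (metis dot_lmul_matrix inner_commute transpose_matrix_vector)

lemma inner_symmetric_mult:
  fixes M :: "real^'n^'n"
  assumes "transpose M = M"
  shows "x \<bullet> (M *v y) = (M *v x) \<bullet> y"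
  using inner_transpose_mult[of x M y] by (simp add: assms)

lemmas matrix_vector_expand = matrix_vector_mult_add_rdistrib matrix_vector_mult_diff_rdistrib
  scaleR_matrix_vector matrix_vector_mul_assoc[symmetric] matrix_vector_right_distrib
  matrix_vector_mult_diff_distrib matrix_vector_mult_scaleR

lemma pos_def_nonneg: "pos_def M \<Longrightarrow> 0 \<le> x \<bullet> (M *v x)"
  by (cases "x = 0") (auto simp: pos_def_def less_imp_le)

section \<open>Lyapunov matrices of Hurwitz matrices\<close>

text \<open>The first \<open>DIM('a) + 1\<close> values are linearly dependent. The coefficients are
  packed into a polynomial, so that the powers of a matrix yield an annihilating polynomial. A
  repeated value is invisible in the set of values; there the relation is the difference of the two
  equal terms.\<close>

lemma nontrivial_linear_relation:
  fixes f :: "nat \<Rightarrow> 'a::euclidean_space"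
  shows "\<exists>p :: real poly. p \<noteq> 0 \<and> (\<Sum>i\<le>degree p. coeff p i *\<^sub>R f i) = 0"
proof -
  define D where "D = DIM('a)"
  have "\<exists>c. (\<exists>i\<le>D. c i \<noteq> 0) \<and> (\<Sum>i\<le>D. c i *\<^sub>R f i) = 0"
  proof (cases "inj_on f {..D}")
    case True
    then have "card (f ` {..D}) = Suc D"
      by (simp add: card_image)
    then have "dependent (f ` {..D})"
      using independent_bound[of "f ` {..D}"] D_def by fastforce
    then obtain u v where u: "v \<in> f ` {..D}" "u v \<noteq> 0" "(\<Sum>v\<in>f ` {..D}. u v *\<^sub>R v) = 0"
      using dependent_finite[of "f ` {..D}"] by auto
    then show ?thesis
      using True by (intro exI[of _ "u \<circ> f"]) (auto simp: sum.reindex)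
  next
    case False
    then obtain i j where ij: "i \<le> D" "j \<le> D" "i \<noteq> j" "f i = f j"
      by (auto simp: inj_on_def)
    have "(\<Sum>k\<le>D. (if k = i then 1 else if k = j then -1 else 0) *\<^sub>R f k)
        = (\<Sum>k\<le>D. (if k = i then f i else 0) - (if k = j then f j else 0))"
      using ij by (intro sum.cong) auto
    also have "\<dots> = 0"
      using ij by (simp add: sum_subtractf)
    finally show ?thesis
      using ij by (intro exI[of _ "\<lambda>k. if k = i then 1 else if k = j then -1 else 0"]) auto
  qed
  then obtain c i where c: "i \<le> D" "c i \<noteq> 0" "(\<Sum>i\<le>D. c i *\<^sub>R f i) = 0"
    by blast
  define p where "p = Abs_poly (\<lambda>i. if i \<le> D then c i else 0)"
  have p: "coeff p k = (if k \<le> D then c k else 0)" for k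
    unfolding p_def by (subst coeff_Abs_poly[of D]) auto
  have "(\<Sum>i\<le>degree p. coeff p i *\<^sub>R f i) = (\<Sum>i\<le>D. coeff p i *\<^sub>R f i)"
    by (rule sum.mono_neutral_left)
      (auto simp: coeff_eq_0 not_le, auto intro!: degree_le simp: p)
  moreover have "p \<noteq> 0"
    using c p[of i] by auto
  ultimately show ?thesis
    using c(3) p by auto
qed

section \<open>Eigenvalue factors of an annihilating polynomial\<close>

fun lin_factors :: "complex^'n^'n \<Rightarrow> complex list \<Rightarrow> complex^'n \<Rightarrow> complex^'n" where
  "lin_factors M [] v = v"
| "lin_factors M (s # ss) v = lin_factors M ss (M *v v - s *s v)"

text \<open>All factors are polynomials in \<open>M\<close> and commute. This moves a chosen factor
  to the outermost place, where its injectivity can be used.\<close>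

lemma lin_factors_commute:
  "lin_factors M ss (M *v v - s *s v) = M *v lin_factors M ss v - s *s lin_factors M ss v"
proof (induction ss arbitrary: v)
  case (Cons r ss)
  have "M *v (M *v v - s *s v) - r *s (M *v v - s *s v)
      = M *v (M *v v - r *s v) - s *s (M *v v - r *s v)"
    by (simp add: matrix_vector_mult_diff_distrib vector_scalar_commute vector_ssub_ldistrib
        vector_smult_assoc mult.commute)
  then show ?case
    using Cons by (metis lin_factors.simps(2))
qed simp

definition poly_apply :: "complex poly \<Rightarrow> complex^'n^'n \<Rightarrow> complex^'n \<Rightarrow> complex^'n" where
  "poly_apply p M v = (\<Sum>i\<le>degree p. coeff p i *s (((*v) M) ^^ i) v)"

lemma poly_apply_bound:
  assumes "degree p \<le> n"
  shows "poly_apply p M v = (\<Sum>i\<le>n. coeff p i *s (((*v) M) ^^ i) v)"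
  unfolding poly_apply_def
  by (rule sum.mono_neutral_left) (use assms in \<open>auto simp: coeff_eq_0\<close>)

lemma matrix_vector_funpow_diff:
  fixes M :: "complex^'n^'n"
  shows "(((*v) M) ^^ i) (v - w) = (((*v) M) ^^ i) v - (((*v) M) ^^ i) w"
  by (induction i) (auto simp: matrix_vector_mult_diff_distrib)

lemma matrix_vector_funpow_scale:
  fixes M :: "complex^'n^'n"
  shows "(((*v) M) ^^ i) (a *s v) = a *s (((*v) M) ^^ i) v"
  by (induction i) (auto simp: vector_scalar_commute)

lemma poly_apply_linear_factor:
  "poly_apply ([:-s, 1:] * q) M v = poly_apply q M (M *v v - s *s v)"
proof -
  define n where "n = degree q"
  have deg: "degree ([:-s, 1:] * q) \<le> Suc n"
    using degree_mult_le[of "[:-s, 1:]" q] by (simp add: n_def)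
  let ?f = "\<lambda>i. (((*v) M) ^^ i) v"
  have "poly_apply q M (M *v v - s *s v) = (\<Sum>i\<le>n. coeff q i *s ?f (Suc i)) - (\<Sum>i\<le>n. (coeff q i * s) *s ?f i)"
    by (simp add: poly_apply_def n_def matrix_vector_funpow_diff matrix_vector_funpow_scale
        vector_ssub_ldistrib sum_subtractf funpow_swap1 del: funpow.simps)
       (simp add: funpow_swap1)
  moreover have "poly_apply ([:-s, 1:] * q) M v
      = (\<Sum>i\<le>Suc n. (case i of 0 \<Rightarrow> 0 | Suc j \<Rightarrow> coeff q j) *s ?f i) - (\<Sum>i\<le>Suc n. (coeff q i * s) *s ?f i)"
    unfolding poly_apply_bound[OF deg] sum_subtractf[symmetric]
    by (intro sum.cong) (auto simp: coeff_pCons vec_eq_iff algebra_simps split: nat.split)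
  \<comment> \<open>The shifted sum starts with a zero term, and the top term of the other sum
    vanishes because \<open>Suc n\<close> exceeds \<open>degree q\<close>.\<close>
  moreover have "\<dots> = (\<Sum>i\<le>n. coeff q i *s ?f (Suc i)) - (\<Sum>i\<le>n. (coeff q i * s) *s ?f i)"
    by (subst sum.atMost_Suc_shift) (simp add: n_def coeff_eq_0)
  ultimately show ?thesis by simp
qed

lemma eigenvalue_factors_of_annihilator:
  fixes M :: "complex^'n^'n"
  assumes "p \<noteq> 0"
  shows "\<exists>ss. (\<forall>s\<in>set ss. \<exists>v. v \<noteq> 0 \<and> M *v v = s *s v)
    \<and> (\<forall>v. poly_apply p M v = 0 \<longrightarrow> lin_factors M ss v = 0)"
  using assms
proof (induction "degree p" arbitrary: p)
  case 0
  then obtain a where "p = [:a:]" "a \<noteq> 0"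
    by (metis degree_eq_zeroE pCons_eq_0_iff)
  then show ?case
    by (intro exI[of _ "[]"]) (auto simp: poly_apply_def)
next
  case (Suc d)
  then obtain s where "poly p s = 0"
    using fundamental_theorem_of_algebra[of p] by (auto simp: constant_degree)
  then obtain q where q: "p = [:-s, 1:] * q"
    by (auto simp: poly_eq_0_iff_dvd)
  then have "q \<noteq> 0"
    using Suc by auto
  then have "degree p = Suc (degree q)"
    unfolding q by (subst degree_mult_eq) auto
  then obtain ss where ss: "\<forall>s\<in>set ss. \<exists>v. v \<noteq> 0 \<and> M *v v = s *s v"
    "\<forall>v. poly_apply q M v = 0 \<longrightarrow> lin_factors M ss v = 0"
    using Suc.hyps(1)[of q] Suc.hyps(2) \<open>q \<noteq> 0\<close> by auto
  have *: "lin_factors M (s # ss) v = 0" if "poly_apply p M v = 0" for v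
    using ss(2) that unfolding q poly_apply_linear_factor by simp
  show ?case
  proof (cases "\<exists>v. v \<noteq> 0 \<and> M *v v = s *s v")
    case True
    then show ?thesis
      using ss * by (intro exI[of _ "s # ss"]) auto
  next
    case False
    \<comment> \<open>By commutation \<open>M - s\<close> acts last, and its kernel is trivial, so
      it cancels.\<close>
    have "lin_factors M ss v = 0" if "poly_apply p M v = 0" for v
      using *[OF that] False unfolding lin_factors.simps lin_factors_commute by auto
    then show ?thesis
      using ss(1) by blast
  qed
qed

definition cvec :: "real^'n \<Rightarrow> complex^'n" where
  "cvec x = (\<chi> i. complex_of_real (x $ i))"

lemma complex_mat_cvec: "complex_mat M *v cvec x = cvec (M *v x)"
  by (simp add: complex_mat_def cvec_def matrix_vector_mult_def vec_eq_iff)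

lemma cvec_add: "cvec (x + y) = cvec x + cvec y"
  by (simp add: cvec_def vec_eq_iff)

lemma cvec_scaleR: "cvec (r *\<^sub>R x) = r *\<^sub>R cvec x"
  by (simp add: cvec_def vec_eq_iff scaleR_conv_of_real[where 'a = complex])

lemma linear_cvec: "linear cvec"
  by (intro linearI) (auto simp: cvec_add cvec_scaleR)

lemma inner_cvec: "cvec x \<bullet> cvec y = x \<bullet> y"
  by (simp add: cvec_def inner_vec_def inner_complex_def)

text \<open>The inner product on \<open>complex^'n\<close> is the real part of the Hermitian one.
  Hence only \<open>Re s\<close> enters, and a negative real part gives decay.\<close>

lemma inner_smult_self:
  fixes x :: "complex^'n"
  shows "x \<bullet> (s *s x) = Re s * (x \<bullet> x)"
  by (simp add: inner_vec_def inner_complex_def sum_distrib_left algebra_simps)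


text \<open>The form for a list \<open>s # ss\<close> is \<open>x \<bullet> y + k * b ((M - s) x) ((M - s) y)\<close> with \<open>b\<close> the form
  for \<open>ss\<close> and \<open>k\<close> large; the second term absorbs the cross term \<open>x \<bullet> (M - s) x\<close>.\<close>

lemma lyapunov_form_of_factors:
  fixes M :: "complex^'n^'n"
  assumes "\<forall>s\<in>set ss. Re s < 0"
  shows "\<exists>(b :: complex^'n \<Rightarrow> complex^'n \<Rightarrow> real) \<eta>. \<eta> > 0 \<and> bilinear b \<and> (\<forall>x y. b x y = b y x)
    \<and> (\<forall>x. x \<bullet> x \<le> b x x)
    \<and> (\<forall>x. lin_factors M ss x = 0 \<longrightarrow> b x (M *v x) \<le> - \<eta> * (x \<bullet> x))"
  using assms
proof (induction ss)
  case Nil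
  \<comment> \<open>The empty list forces \<open>x = 0\<close>, so the decay estimate is trivial and
    any \<open>\<eta>\<close> serves.\<close>
  show ?case
    by (rule exI[of _ inner], rule exI[of _ 1])
      (auto simp: bilinear_conv_bounded_bilinear bounded_bilinear_inner inner_commute)
next
  case (Cons s ss)
  then obtain b :: "complex^'n \<Rightarrow> complex^'n \<Rightarrow> real" and \<eta> where b: "\<eta> > 0" "bilinear b" "\<And>x y. b x y = b y x"
    "\<And>x. x \<bullet> x \<le> b x x" "\<And>x. lin_factors M ss x = 0 \<Longrightarrow> b x (M *v x) \<le> - \<eta> * (x \<bullet> x)"
    by auto
  define a where "a = - Re s"
  have a: "a > 0"
    using Cons.prems by (simp add: a_def)
  define g where "g x = M *v x - s *s x" for x
  \<comment> \<open>With this value the decay of the second term is exactly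
    \<open>(y \<bullet> y) / (2 * a)\<close>, the price of splitting \<open>x \<bullet> y\<close> at
    the cost of half of the decay in \<open>x\<close>.\<close>
  define k where "k = 1 / (2 * a * \<eta>)"
  have k: "k > 0"
    using a b(1) by (simp add: k_def)
  define b' where "b' x y = x \<bullet> y + k * b (g x) (g y)" for x y
  have g: "g (x + y) = g x + g y" "g (r *\<^sub>R x) = r *\<^sub>R g x" for x y r
    by (auto simp: g_def matrix_vector_right_distrib vector_add_ldistrib vec_eq_iff
        scaleR_vec_def matrix_vector_mult_def sum_distrib_left sum.distrib algebra_simps scaleR_sum_right)
  have bil: "bilinear b'"
    unfolding bilinear_def b'_def
    by (auto intro!: linearI simp: g bilinear_ladd[OF b(2)] bilinear_radd[OF b(2)] bilinear_lmul[OF b(2)]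
        bilinear_rmul[OF b(2)] inner_left_distrib inner_right_distrib algebra_simps)
  have pos: "x \<bullet> x \<le> b' x x" for x
    using order_trans[OF inner_ge_zero b(4)[of "g x"]] k by (simp add: b'_def)
  have main: "b' x (M *v x) \<le> - (a / 2) * (x \<bullet> x)" if "lin_factors M (s # ss) x = 0" for x
  proof -
    define y where "y = g x"
    have y0: "lin_factors M ss y = 0"
      using that by (simp add: y_def g_def)
    have Mx: "M *v x = s *s x + y"
      by (simp add: y_def g_def)
    have gM: "g (M *v x) = M *v y"
      by (simp add: g_def y_def matrix_vector_mult_diff_distrib vector_scalar_commute)
    have "b' x (M *v x) = - a * (x \<bullet> x) + x \<bullet> y + k * b y (M *v y)"
      unfolding b'_def gM y_def[symmetric] by (simp add: Mx inner_right_distrib inner_smult_self a_def)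
    moreover have "k * b y (M *v y) \<le> k * (- \<eta> * (y \<bullet> y))"
      using b(5)[OF y0] k by (intro mult_left_mono) auto
    moreover have "k * (- \<eta> * (y \<bullet> y)) = - (y \<bullet> y) / (2 * a)"
      using a b(1) by (simp add: k_def field_simps)
    moreover have "0 \<le> (a *\<^sub>R x - y) \<bullet> (a *\<^sub>R x - y)"
      by simp
    then have "x \<bullet> y \<le> (a / 2) * (x \<bullet> x) + (y \<bullet> y) / (2 * a)"
      using a by (simp add: inner_diff_left inner_diff_right inner_commute field_simps power2_eq_square)
    ultimately show ?thesis
      by (simp add: field_simps)
  qed
  show ?case
  proof (rule exI[of _ b'], rule exI[of _ "a / 2"], intro conjI allI impI)
    show "b' x y = b' y x" for x y
      by (simp add: b'_def inner_commute b(3))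
  qed (use a bil pos main in auto)
qed

lemma complex_mat_funpow:
  fixes M :: "real^'n^'n"
  shows "((*v) (complex_mat M) ^^ i) v = complex_mat (mat_power M i) *v v"
proof (induction i)
  case (Suc i)
  have "complex_mat (X ** Y) = complex_mat X ** complex_mat Y" for X Y :: "real^'n^'n"
    by (simp add: complex_mat_def matrix_matrix_mult_def vec_eq_iff)
  then show ?case
    using Suc by (simp add: mat_power_def matrix_vector_mul_assoc)
qed (auto simp: mat_power_def complex_mat_def matrix_vector_mult_def mat_def vec_eq_iff
      if_distrib if_distribR cong: if_cong)

text \<open>The powers of \<open>M\<close> are linearly dependent, so some polynomial annihilates
  \<open>M\<close>. Its eigenvalue factors kill every vector, so the form built from them decays
  everywhere; its restriction to real vectors is \<open>P\<close>.\<close>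

lemma hurwitz_lyapunov:
  fixes M :: "real^'n^'n"
  assumes "hurwitz M"
  shows "\<exists>P \<eta>. \<eta> > 0 \<and> pos_def P \<and> (\<forall>x. (M *v x) \<bullet> (P *v x) \<le> - \<eta> * (x \<bullet> x))"
proof -
  obtain p :: "real poly" where p: "p \<noteq> 0" "(\<Sum>i\<le>degree p. coeff p i *\<^sub>R mat_power M i) = 0"
    using nontrivial_linear_relation[of "mat_power M"] by blast
  define q where "q = map_poly complex_of_real p"
  have q0: "q \<noteq> 0"
    using p(1) by (simp add: q_def map_poly_eq_0_iff)
  have ann: "poly_apply q (complex_mat M) v = 0" for v
  proof -
    have "poly_apply q (complex_mat M) v
      = (\<Sum>i\<le>degree p. complex_of_real (coeff p i) *s (complex_mat (mat_power M i) *v v))"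
      by (simp add: poly_apply_def q_def coeff_map_poly degree_map_poly complex_mat_funpow)
    also have "\<dots> = complex_mat (\<Sum>i\<le>degree p. coeff p i *\<^sub>R mat_power M i) *v v"
      by (simp add: vec_eq_iff matrix_vector_mult_def complex_mat_def sum_distrib_left
          sum_distrib_right mult.assoc sum.swap[of _ "{..degree p}"])
    finally show ?thesis
      using p(2) by (simp add: complex_mat_def matrix_vector_mult_def vec_eq_iff)
  qed
  obtain ss where ss: "\<forall>s\<in>set ss. \<exists>v. v \<noteq> 0 \<and> complex_mat M *v v = s *s v"
    "\<And>v. lin_factors (complex_mat M) ss v = 0"
    using eigenvalue_factors_of_annihilator[OF q0, of "complex_mat M"] ann by blast
  have "\<forall>s\<in>set ss. Re s < 0"
    using ss(1) assms by (auto simp: hurwitz_def)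
  from lyapunov_form_of_factors[OF this, of "complex_mat M"]
  obtain b :: "complex^'n \<Rightarrow> complex^'n \<Rightarrow> real" and \<eta> where b: "\<eta> > 0" "bilinear b" "\<And>x y. b x y = b y x"
    "\<And>x. x \<bullet> x \<le> b x x" "\<And>x. b x (complex_mat M *v x) \<le> - \<eta> * (x \<bullet> x)"
    using ss(2) by auto
  define P :: "real^'n^'n" where "P = (\<chi> i j. b (cvec (axis i 1)) (cvec (axis j 1)))"
  have expand: "x = (\<Sum>i\<in>UNIV. x $ i *\<^sub>R axis i 1)" for x :: "real^'n"
    using basis_expansion[of x] by (simp add: scalar_mult_eq_scaleR)
  have lin: "linear (b z)" "linear (\<lambda>z. b z w)" for z w
    using b(2) by (auto simp: bilinear_def)
  have P: "x \<bullet> (P *v y) = b (cvec x) (cvec y)" for x y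
  proof -
    have "b (cvec x) (cvec y) = b (\<Sum>i\<in>UNIV. x $ i *\<^sub>R cvec (axis i 1)) (\<Sum>j\<in>UNIV. y $ j *\<^sub>R cvec (axis j 1))"
      by (subst expand[of x], subst expand[of y])
        (simp add: linear_sum[OF linear_cvec] cvec_scaleR del: sum_component)
    also have "\<dots> = x \<bullet> (P *v y)"
      by (simp add: linear_sum[OF lin(1)] linear_sum[OF lin(2)] linear_scale[OF lin(1)]
          linear_scale[OF lin(2)] P_def inner_vec_def matrix_vector_mult_def sum_distrib_left algebra_simps)
        (rule sum.swap)
    finally show ?thesis ..
  qed
  have "transpose P = P"
    by (simp add: P_def transpose_def vec_eq_iff b(3))
  moreover have "0 < x \<bullet> (P *v x)" if "x \<noteq> 0" for x
    using b(4)[of "cvec x"] that by (simp add: P inner_cvec)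
      (metis inner_gt_zero_iff order_less_le_trans)
  moreover have "(M *v x) \<bullet> (P *v x) \<le> - \<eta> * (x \<bullet> x)" for x
    using b(5)[of "cvec x"] by (simp add: P complex_mat_cvec b(3)[of "cvec (M *v x)"] inner_cvec)
  ultimately show ?thesis
    using b(1) unfolding pos_def_def by blast
qed

text \<open>Compactness of the unit sphere gives a positive minimum, and homogeneity extends it to
  all vectors.\<close>

lemma pos_def_lower_bound:
  assumes "\<And>x. x \<noteq> 0 \<Longrightarrow> 0 < x \<bullet> (M *v x)"
  shows "\<exists>a>0. \<forall>x :: real^'n. a * (x \<bullet> x) \<le> x \<bullet> (M *v x)"
proof -
  have "\<exists>u\<in>sphere 0 1. \<forall>x\<in>sphere (0 :: real^'n) 1. u \<bullet> (M *v u) \<le> x \<bullet> (M *v x)"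
    by (intro continuous_attains_inf continuous_intros compact_sphere) (auto simp: linear_continuous_on matrix_vector_mul_bounded_linear)
  then obtain u :: "real^'n" where u: "norm u = 1" "\<And>x. norm x = 1 \<Longrightarrow> u \<bullet> (M *v u) \<le> x \<bullet> (M *v x)"
    by auto
  define a where "a = u \<bullet> (M *v u)"
  have "a > 0"
    unfolding a_def using u(1) by (intro assms) auto
  moreover have "a * (x \<bullet> x) \<le> x \<bullet> (M *v x)" for x
  proof (cases "x = 0")
    case False
    then have "a \<le> (x /\<^sub>R norm x) \<bullet> (M *v (x /\<^sub>R norm x))"
      unfolding a_def by (intro u(2)) auto
    also have "\<dots> = (x \<bullet> (M *v x)) / (norm x)\<^sup>2"
      by (simp add: matrix_vector_mult_scaleR power2_eq_square divide_inverse)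
    finally show ?thesis
      using False by (simp add: field_simps power2_norm_eq_inner[symmetric])
  qed simp
  ultimately show ?thesis by blast
qed

lemma neg_def_upper_bound:
  assumes "neg_def M"
  shows "\<exists>a>0. \<forall>x :: real^'n. x \<bullet> (M *v x) \<le> - a * (x \<bullet> x)"
proof -
  have "0 < x \<bullet> (- M *v x)" if "x \<noteq> 0" for x
    using assms that by (simp add: neg_def_def scaleR_matrix_vector[of "-1", simplified])
  from pos_def_lower_bound[OF this]
  obtain a where "a > 0" "\<And>x. a * (x \<bullet> x) \<le> x \<bullet> (- M *v x)"
    by blast
  then show ?thesis
    by (intro exI[of _ a]) (auto simp: scaleR_matrix_vector[of "-1", simplified] le_minus_iff)
qed

lemma mult_norm_le:
  fixes M :: "real^'n^'m"
  shows "\<exists>K>0. \<forall>x. norm (M *v x) \<le> K * norm x"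
  using bounded_linear.pos_bounded[OF matrix_vector_mul_bounded_linear[of M]]
  by (auto simp: mult.commute)

lemma square_norm_le:
  fixes M :: "real^'n^'m"
  shows "\<exists>K>0. \<forall>x. (M *v x) \<bullet> (M *v x) \<le> K * (x \<bullet> x)"
proof -
  obtain K where K: "K > 0" "\<And>x. norm (M *v x) \<le> K * norm x"
    using mult_norm_le by metis
  have "(M *v x) \<bullet> (M *v x) \<le> K\<^sup>2 * (x \<bullet> x)" for x
    using power_mono[OF K(2)[of x], of 2] by (simp add: power2_norm_eq_inner power_mult_distrib)
  then show ?thesis
    using K(1) by (intro exI[of _ "K\<^sup>2"]) auto
qed

text \<open>With \<open>F\<close> stabilizing, \<open>P\<^sub>0\<close> a Lyapunov matrix of \<open>A + BF\<close> and \<open>P = k P\<^sub>0\<close>, the term quadratic in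
  \<open>P\<close> grows like \<open>k\<^sup>2\<close> and absorbs the feedback, while the Lyapunov decay grows like \<open>k\<close> and absorbs
  the constant term.\<close>

lemma riccati_inequality_solvable:
  fixes A :: "real^'n^'n" and B :: "real^'m^'n" and C :: "real^'n^'p"
  assumes stab: "stabilizable A B" and g: "g < 0" and "0 \<le> l"
  shows "\<exists>P. pos_def P \<and> neg_def (transpose A ** P + P ** A
    + g *\<^sub>R (P ** B ** transpose B ** P) + l *\<^sub>R (transpose C ** C))"
proof -
  obtain F :: "real^'n^'m" where "hurwitz (A + B ** F)"
    using stab by (auto simp: stabilizable_def)
  then obtain P0 \<eta> where P0: "\<eta> > 0" "pos_def P0"
    "\<And>x. ((A + B ** F) *v x) \<bullet> (P0 *v x) \<le> - \<eta> * (x \<bullet> x)"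
    using hurwitz_lyapunov by metis
  obtain K where K: "K > 0" "\<And>x. (F *v x) \<bullet> (F *v x) \<le> K * (x \<bullet> x)"
    using square_norm_le[of F] by metis
  obtain K' where K': "K' > 0" "\<And>x. (C *v x) \<bullet> (C *v x) \<le> K' * (x \<bullet> x)"
    using square_norm_le[of C] by metis
  \<comment> \<open>The first entry lets the quadratic term absorb the feedback (\<open>k1\<close>);
    the second lets the decay absorb the term in \<open>C\<close> with a margin of 1
    (\<open>k2\<close>).\<close>
  define k where "k = max (K / (\<eta> * (- g))) ((l * K' + 1) / \<eta>)"
  have "0 < (l * K' + 1) / \<eta>"
    using P0(1) K'(1) \<open>0 \<le> l\<close> by (intro divide_pos_pos add_nonneg_pos) auto
  then have k0: "k > 0"
    by (auto simp: k_def less_max_iff_disj)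
  have k1: "K / \<eta> \<le> k * (- g)"
  proof -
    have "K / (\<eta> * (- g)) * (- g) \<le> k * (- g)"
      using g by (intro mult_right_mono) (auto simp: k_def)
    then show ?thesis
      using g by (simp add: field_simps)
  qed
  have k2: "l * K' + 1 \<le> k * \<eta>"
    using P0(1) by (simp add: k_def max_def field_simps)
  define P where "P = k *\<^sub>R P0"
  have sym: "transpose P0 = P0" "transpose P = P"
    using P0(2) by (auto simp: pos_def_def P_def transpose_scalar)
  have pd: "pos_def P"
    using P0(2) k0 by (auto simp: pos_def_def P_def transpose_scalar scaleR_matrix_vector)
  let ?M = "transpose A ** P + P ** A + g *\<^sub>R (P ** B ** transpose B ** P) + l *\<^sub>R (transpose C ** C)"
  have "transpose ?M = ?M"
    by (simp add: transpose_add transpose_scalar matrix_transpose_mul sym matrix_mul_assoc add.commute)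
  moreover have "x \<bullet> (?M *v x) < 0" if "x \<noteq> 0" for x
  proof -
    \<comment> \<open>Built from \<open>P0\<close> rather than \<open>P\<close>, so that the powers
      of \<open>k\<close> stay visible.\<close>
    define b where "b = transpose B *v (P0 *v x)"

    have "x \<bullet> (P0 *v (A *v x)) = (A *v x) \<bullet> (P0 *v x)"
      by (subst inner_symmetric_mult[OF sym(1)]) (rule inner_commute)
    moreover have "x \<bullet> (P0 *v (B *v b)) = b \<bullet> b"
      by (subst inner_symmetric_mult[OF sym(1)])
        (metis b_def inner_commute inner_transpose_mult)
    ultimately have "x \<bullet> (?M *v x) = 2 * k * ((A *v x) \<bullet> (P0 *v x)) + g * k\<^sup>2 * (b \<bullet> b) + l * ((C *v x) \<bullet> (C *v x))"
      by (simp add: matrix_vector_expand P_def inner_add_right inner_transpose_mult power2_eq_square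
          matrix_scaleR_left matrix_scaleR_right b_def[symmetric])
    moreover have "l * ((C *v x) \<bullet> (C *v x)) \<le> l * (K' * (x \<bullet> x))"
      using K'(2) \<open>0 \<le> l\<close> by (rule mult_left_mono)
    moreover have *: "(A *v x) \<bullet> (P0 *v x) \<le> - \<eta> * (x \<bullet> x) - (F *v x) \<bullet> b"
    proof -
      have "(B *v (F *v x)) \<bullet> (P0 *v x) = (F *v x) \<bullet> b"
        by (simp add: b_def inner_transpose_mult)
      then show ?thesis
        using P0(3)[of x] by (simp add: matrix_vector_expand inner_add_left)
    qed
    moreover have **: "- (F *v x) \<bullet> b \<le> \<eta> / 2 * (x \<bullet> x) + K / (2 * \<eta>) * (b \<bullet> b)"
    proof -
      \<comment> \<open>The weights are chosen so that, once \<open>F *v x\<close> is bounded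
        through \<open>K\<close>, every term carries a factor \<open>K\<close>, which then
        cancels.\<close>
      have "0 \<le> (\<eta> *\<^sub>R (F *v x) + K *\<^sub>R b) \<bullet> (\<eta> *\<^sub>R (F *v x) + K *\<^sub>R b)"
        by simp
      then have "- (2 * \<eta> * K * ((F *v x) \<bullet> b)) \<le> \<eta>\<^sup>2 * ((F *v x) \<bullet> (F *v x)) + K\<^sup>2 * (b \<bullet> b)"
        by (simp add: inner_add_left inner_add_right inner_commute power2_eq_square algebra_simps)
      also have "\<dots> \<le> \<eta>\<^sup>2 * (K * (x \<bullet> x)) + K\<^sup>2 * (b \<bullet> b)"
        using K(2)[of x] by (intro add_right_mono mult_left_mono) auto
      finally have "K * (- (2 * \<eta> * ((F *v x) \<bullet> b))) \<le> K * (\<eta>\<^sup>2 * (x \<bullet> x) + K * (b \<bullet> b))"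
        by (simp add: algebra_simps power2_eq_square)
      then have "- (2 * \<eta> * ((F *v x) \<bullet> b)) \<le> \<eta>\<^sup>2 * (x \<bullet> x) + K * (b \<bullet> b)"
        using K(1) by (simp only: mult_le_cancel_left_pos)
      then show ?thesis
        using P0(1) by (simp add: field_simps power2_eq_square)
    qed
    ultimately have "x \<bullet> (?M *v x) \<le> 2 * k * (- \<eta> / 2 * (x \<bullet> x) + K / (2 * \<eta>) * (b \<bullet> b))
        + g * k\<^sup>2 * (b \<bullet> b) + l * (K' * (x \<bullet> x))"
    proof -
      have "(A *v x) \<bullet> (P0 *v x) \<le> - \<eta> / 2 * (x \<bullet> x) + K / (2 * \<eta>) * (b \<bullet> b)"
        using * ** by (simp add: field_simps)
      then have "2 * k * ((A *v x) \<bullet> (P0 *v x)) \<le> 2 * k * (- \<eta> / 2 * (x \<bullet> x) + K / (2 * \<eta>) * (b \<bullet> b))"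
        using k0 by (intro mult_left_mono) auto
      then show ?thesis
        using \<open>x \<bullet> (?M *v x) = _\<close> \<open>l * _ \<le> l * _\<close> by linarith
    qed
    \<comment> \<open>Collecting the squares leaves a coefficient at most -1 for
      \<open>x \<bullet> x\<close> and at most 0 for \<open>b \<bullet> b\<close>.\<close>
    also have "\<dots> = (l * K' - k * \<eta>) * (x \<bullet> x) + k * (K / \<eta> - k * (- g)) * (b \<bullet> b)"
      using P0(1) by (simp add: field_simps power2_eq_square)
    also have "\<dots> \<le> - 1 * (x \<bullet> x) + 0 * (b \<bullet> b)"
      using k1 k2 k0 by (intro add_mono mult_right_mono) (auto simp: mult_le_0_iff)
    finally show ?thesis
      using that by (simp add: order_le_less_trans)
  qed
  ultimately have "neg_def ?M"
    by (simp add: neg_def_def)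
  then show ?thesis
    using pd by blast
qed

section \<open>Spectrum of the Laplacian\<close>

text \<open>A maximizer \<open>u\<close> of the Rayleigh quotient on the unit sphere of
  \<open>T\<close> is an eigenvector: its residual \<open>r\<close> lies in \<open>T\<close> by
  invariance, and moving \<open>u\<close> along \<open>r\<close> would increase the quotient to
  first order unless \<open>r = 0\<close>.\<close>

lemma rayleigh_maximizer_eigenvector:
  fixes M :: "real^'n^'n" and T :: "(real^'n) set"
  assumes sym: "transpose M = M" and T: "subspace T" "\<And>x. x \<in> T \<Longrightarrow> M *v x \<in> T"
    and ne: "T \<noteq> {0}"
  shows "\<exists>u m. u \<in> T \<and> norm u = 1 \<and> M *v u = m *\<^sub>R u"
proof -
  have ex: "\<exists>z\<in>T. z \<noteq> 0"
    using ne subspace_0[OF T(1)] by blast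
  have "compact (T \<inter> sphere 0 1)"
    by (intro closed_Int_compact compact_sphere closed_subspace T(1))
  moreover have "T \<inter> sphere 0 1 \<noteq> {}"
  proof -
    obtain z where "z \<in> T" "z \<noteq> 0"
      using ex by blast
    then have "z /\<^sub>R norm z \<in> T \<inter> sphere 0 1"
      using T(1) by (auto simp: subspace_def)
    then show ?thesis by blast
  qed
  ultimately have "\<exists>u\<in>T \<inter> sphere 0 1. \<forall>x\<in>T \<inter> sphere 0 1. x \<bullet> (M *v x) \<le> u \<bullet> (M *v u)"
    by (intro continuous_attains_sup continuous_intros) (auto simp: linear_continuous_on)
  then obtain u where u: "u \<in> T" "norm u = 1" "\<And>x. x \<in> T \<Longrightarrow> norm x = 1 \<Longrightarrow> x \<bullet> (M *v x) \<le> u \<bullet> (M *v u)"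
    by auto
  define m where "m = u \<bullet> (M *v u)"
  have le: "x \<bullet> (M *v x) \<le> m * (x \<bullet> x)" if "x \<in> T" for x
  proof (cases "x = 0")
    case False
    have "(x /\<^sub>R norm x) \<bullet> (M *v (x /\<^sub>R norm x)) \<le> m"
      unfolding m_def using that T(1) False by (intro u(3)) (auto simp: subspace_def)
    then have "(x \<bullet> (M *v x)) / (norm x)\<^sup>2 \<le> m"
      by (simp add: matrix_vector_mult_scaleR power2_eq_square divide_inverse mult_ac)
    then show ?thesis
      using False by (simp add: field_simps power2_norm_eq_inner[symmetric])
  qed simp
  define r where "r = M *v u - m *\<^sub>R u"
  have r: "r \<in> T"
    using T u(1) by (simp add: r_def subspace_diff subspace_mul)
  have Mur: "u \<bullet> (M *v r) = r \<bullet> (M *v u)"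
    by (subst inner_symmetric_mult[OF sym]) (rule inner_commute)
  have uu: "u \<bullet> u = 1"
    using u(2) by (simp add: norm_eq_1)
  have key: "2 * t * (r \<bullet> r) \<le> t\<^sup>2 * (m * (r \<bullet> r) - r \<bullet> (M *v r))" for t
  proof -
    have le_t: "(u + t *\<^sub>R r) \<bullet> (M *v (u + t *\<^sub>R r)) \<le> m * ((u + t *\<^sub>R r) \<bullet> (u + t *\<^sub>R r))"
      using T(1) u(1) r by (intro le) (auto simp: subspace_def)
    have e1: "(u + t *\<^sub>R r) \<bullet> (M *v (u + t *\<^sub>R r)) = m + 2 * t * (r \<bullet> (M *v u)) + t\<^sup>2 * (r \<bullet> (M *v r))"
      by (simp add: matrix_vector_expand inner_add_left inner_add_right Mur m_def power2_eq_square algebra_simps)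
    have e2: "(u + t *\<^sub>R r) \<bullet> (u + t *\<^sub>R r) = 1 + 2 * t * (r \<bullet> u) + t\<^sup>2 * (r \<bullet> r)"
      by (simp add: inner_add_left inner_add_right uu inner_commute power2_eq_square algebra_simps)
    have e3: "r \<bullet> (M *v u) = r \<bullet> r + m * (r \<bullet> u)"
      by (simp add: r_def inner_diff_right inner_diff_left)
    show ?thesis
      using le_t unfolding e1 e2 e3 by (simp add: algebra_simps)
  qed
  have "r \<bullet> r \<le> 0"
  proof (rule ccontr)
    assume "\<not> r \<bullet> r \<le> 0"
    then have pos: "r \<bullet> r > 0" by linarith
    \<comment> \<open>A strictly positive bound of the second-order coefficient. With
      \<open>t = (r \<bullet> r) / d\<close> the quadratic term equals
      \<open>t * (r \<bullet> r)\<close>, which is below the linear term.\<close>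
    define d where "d = \<bar>m * (r \<bullet> r) - r \<bullet> (M *v r)\<bar> + r \<bullet> r"
    have d: "d > 0" "m * (r \<bullet> r) - r \<bullet> (M *v r) \<le> d"
      using pos unfolding d_def by linarith+
    define t where "t = (r \<bullet> r) / d"
    have "2 * t * (r \<bullet> r) \<le> t\<^sup>2 * d"
      using key[of t] mult_left_mono[OF d(2), of "t\<^sup>2"] by simp
    also have "\<dots> = t * (r \<bullet> r)"
      using d(1) by (simp add: t_def power2_eq_square)
    finally have "2 * (t * (r \<bullet> r)) \<le> t * (r \<bullet> r)"
      by (simp only: mult.assoc)
    moreover have "0 < t * (r \<bullet> r)"
      unfolding t_def using pos d(1) by (intro mult_pos_pos divide_pos_pos)
    ultimately show False
      by linarith
  qed
  then have "r = 0"
    by (metis inner_eq_zero_iff inner_ge_zero order_antisym)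
  then show ?thesis
    using u(1,2) by (auto simp: r_def)
qed

text \<open>A maximal orthonormal set of eigenvectors is a basis. Otherwise its orthogonal
  complement is nonzero, invariant because \<open>M\<close> is symmetric, and hence contains a
  further eigenvector.\<close>

lemma symmetric_orthonormal_eigenbasis:
  fixes M :: "real^'n^'n"
  assumes sym: "transpose M = M"
  shows "\<exists>(v :: 'n \<Rightarrow> real^'n) \<mu>. (\<forall>i j. v i \<bullet> v j = (if i = j then 1 else 0)) \<and> (\<forall>i. M *v v i = \<mu> i *\<^sub>R v i)"
proof -
  define ok where "ok S \<longleftrightarrow> pairwise orthogonal S \<and> (\<forall>u\<in>S. norm u = 1 \<and> (\<exists>m. M *v u = m *\<^sub>R u))" for S
  have bnd: "independent S \<and> finite S \<and> card S \<le> CARD('n)" if "ok S" for S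
  proof -
    have "independent S"
      using that by (intro pairwise_orthogonal_independent) (auto simp: ok_def)
    then show ?thesis
      using independent_bound[of S] by simp
  qed
  have "ok {}"
    by (simp add: ok_def)
  then obtain S where S: "ok S" "\<And>S'. ok S' \<Longrightarrow> card S' \<le> card S"
    using ex_has_greatest_nat[of ok "{}" card "Suc CARD('n)"] bnd by (metis le_imp_less_Suc)
  have "card S = CARD('n)"
  proof (rule ccontr)
    assume ne: "card S \<noteq> CARD('n)"
    define T where "T = {x. \<forall>u\<in>S. orthogonal u x}"
    have "subspace T"
      unfolding T_def by (simp add: subspace_def orthogonal_def inner_add_right)
    moreover have "M *v x \<in> T" if "x \<in> T" for x
    proof -
      have "u \<bullet> (M *v x) = 0" if "u \<in> S" for u
      proof -
        obtain m where "M *v u = m *\<^sub>R u"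
          using S(1) \<open>u \<in> S\<close> by (auto simp: ok_def)
        then show ?thesis
          using \<open>x \<in> T\<close> \<open>u \<in> S\<close> by (simp add: inner_symmetric_mult[OF sym] T_def orthogonal_def)
      qed
      then show ?thesis
        by (simp add: T_def orthogonal_def)
    qed
    moreover have "T \<noteq> {0}"
    proof -
      have "dim S < DIM(real^'n)"
        using bnd[OF S(1)] ne by (simp add: dim_eq_card_independent)
      then have "span S \<noteq> UNIV"
        by (metis dim_UNIV dim_span nat_neq_iff)
      then obtain a where "a \<noteq> 0" "\<forall>x\<in>span S. a \<bullet> x = 0"
        using span_not_UNIV_orthogonal by blast
      then show ?thesis
        by (auto simp: T_def orthogonal_def inner_commute span_base)
    qed
    ultimately obtain u m where u: "u \<in> T" "norm u = 1" "M *v u = m *\<^sub>R u"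
      using rayleigh_maximizer_eigenvector[OF sym, of T] by blast
    have "u \<notin> S"
      using u by (auto simp: T_def orthogonal_def norm_eq_1)
    moreover have "ok (insert u S)"
      using S(1) u by (auto simp: ok_def pairwise_insert T_def orthogonal_commute)
    ultimately show False
      using S(2)[of "insert u S"] bnd[OF S(1)] by simp
  qed
  then obtain v where v: "bij_betw v (UNIV :: 'n set) S"
    using bnd[OF S(1)] by (metis finite_same_card_bij finite_class.finite_UNIV)
  have vS: "v i \<in> S" for i
    using v by (auto simp: bij_betw_def)
  have "v i \<bullet> v j = (if i = j then 1 else 0)" for i j
  proof (cases "i = j")
    case False
    then have "v i \<noteq> v j"
      using v by (auto simp: bij_betw_def inj_on_def)
    then show ?thesis
      using False S(1) vS[of i] vS[of j] by (auto simp: ok_def pairwise_def orthogonal_def)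
  qed (use S(1) vS in \<open>auto simp: ok_def norm_eq_1\<close>)
  moreover have "\<exists>\<mu>. \<forall>i. M *v v i = \<mu> i *\<^sub>R v i"
    using S(1) vS by (intro choice) (auto simp: ok_def)
  ultimately show ?thesis by blast
qed

text \<open>The eigenvectors as columns of \<open>U\<close> diagonalize \<open>mat s - M\<close>,
  and \<open>det U\<close> cancels. This links an eigenbasis to the characteristic polynomial, on
  which \<open>ordered_eigenvalues\<close> rests.\<close>

lemma det_eigenbasis:
  fixes M :: "real^'n^'n" and v :: "'n \<Rightarrow> real^'n"
  assumes v: "\<And>i j. v i \<bullet> v j = (if i = j then 1 else 0)" and ev: "\<And>i. M *v v i = \<mu> i *\<^sub>R v i"
  shows "det (mat s - M) = (\<Prod>i\<in>UNIV. s - \<mu> i)"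
proof -
  define U :: "real^'n^'n" where "U = (\<chi> i j. v j $ i)"
  have UU: "transpose U ** U = mat 1"
    using v by (simp add: U_def matrix_matrix_mult_def transpose_def mat_def inner_vec_def vec_eq_iff)
  have "((mat s - M) ** U) $ i $ j = (s - \<mu> j) * U $ i $ j" for i j
  proof -
    have "((mat s - M) ** U) $ i $ j = ((mat s - M) *v v j) $ i"
      by (simp add: matrix_matrix_mult_def matrix_vector_mult_def U_def)
    also have "mat s = s *\<^sub>R (mat 1 :: real^'n^'n)"
      by (simp add: mat_def vec_eq_iff)
    then have "((mat s - M) *v v j) $ i = (s - \<mu> j) * U $ i $ j"
      by (simp add: matrix_vector_expand ev U_def algebra_simps)
    finally show ?thesis .
  qed
  then have "(mat s - M) ** U = U ** diag_mat (\<lambda>i. s - \<mu> i)"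
    by (simp add: vec_eq_iff)
      (simp add: matrix_matrix_mult_def diag_mat_def if_distrib mult.commute cong: if_cong)
  then have "det (mat s - M) * det U = det U * det (diag_mat (\<lambda>i. s - \<mu> i))"
    by (metis det_mul)
  moreover have "det U \<noteq> 0"
    using UU by (metis det_I det_mul det_transpose mult_eq_0_iff zero_neq_one)
  moreover have "det (diag_mat (\<lambda>i. s - \<mu> i)) = (\<Prod>i\<in>UNIV. s - \<mu> i)"
    by (subst det_diagonal) (auto simp: diag_mat_def)
  ultimately show ?thesis by simp
qed

text \<open>A left inverse of a square matrix is a right inverse, so orthonormal columns entail
  orthonormal rows; the expansion follows from the rows.\<close>

lemma orthonormal_expansion:
  fixes v :: "'n \<Rightarrow> real^'n"
  assumes v: "\<And>i j. v i \<bullet> v j = (if i = j then 1 else 0)"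
  shows "(\<Sum>i\<in>UNIV. (v i $ j) * (v i $ k)) = (if j = k then 1 else 0)"
    and "x = (\<Sum>i\<in>UNIV. (v i \<bullet> x) *\<^sub>R v i)"
proof -
  define U :: "real^'n^'n" where "U = (\<chi> i j. v j $ i)"
  have "transpose U ** U = mat 1"
    using v by (simp add: U_def matrix_matrix_mult_def transpose_def mat_def inner_vec_def vec_eq_iff)
  then have "U ** transpose U = mat 1"
    by (simp add: matrix_left_right_inverse)
  then have "(U ** transpose U) $ j $ k = (mat 1 :: real^'n^'n) $ j $ k" for j k
    by simp
  then show *: "(\<Sum>i\<in>UNIV. (v i $ j) * (v i $ k)) = (if j = k then 1 else 0)" for j k
    by (simp add: U_def matrix_matrix_mult_def transpose_def mat_def)
  have "(\<Sum>i\<in>UNIV. (v i \<bullet> x) * (v i $ j)) = (\<Sum>k\<in>UNIV. (\<Sum>i\<in>UNIV. (v i $ k) * (v i $ j)) * x $ k)" for j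
    unfolding inner_vec_def sum_distrib_right by (subst sum.swap) (simp add: algebra_simps)
  then show "x = (\<Sum>i\<in>UNIV. (v i \<bullet> x) *\<^sub>R v i)"
    by (simp add: vec_eq_iff * if_distrib if_distribR cong: if_cong)
qed

section \<open>Kernel and eigenvalue range of a graph Laplacian\<close>

lemma transpose_laplacian:
  assumes "weighted_graph Adj"
  shows "transpose (laplacian Adj) = laplacian Adj"
  using assms by (auto simp: weighted_graph_def laplacian_def diag_mat_def transpose_def vec_eq_iff)

lemma laplacian_mult_component: "(laplacian Adj *v x) $ i = (\<Sum>j\<in>UNIV. Adj $ i $ j * (x $ i - x $ j))"
  using laplacian_sum[of Adj i "\<lambda>j. vec (x $ j) :: real^1"]
  by (simp add: matrix_vector_mult_def vec_eq_iff)

text \<open>Exchanging the names of the two nodes and adding both versions completes the squares.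
  The factor 2 arises because each unordered pair is counted twice.\<close>

lemma laplacian_quadratic_form:
  assumes "weighted_graph Adj"
  shows "2 * (x \<bullet> (laplacian Adj *v x)) = (\<Sum>i\<in>UNIV. \<Sum>j\<in>UNIV. Adj $ i $ j * (x $ i - x $ j)\<^sup>2)"
proof -
  have *: "x \<bullet> (laplacian Adj *v x) = (\<Sum>i\<in>UNIV. \<Sum>j\<in>UNIV. x $ i * Adj $ i $ j * (x $ i - x $ j))"
    by (simp add: inner_vec_def laplacian_mult_component sum_distrib_left mult.assoc)
  also have "\<dots> = (\<Sum>i\<in>UNIV. \<Sum>j\<in>UNIV. x $ j * Adj $ i $ j * (x $ j - x $ i))"
    using assms by (subst sum.swap) (simp add: weighted_graph_def)
  finally have "2 * (x \<bullet> (laplacian Adj *v x))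
      = (\<Sum>i\<in>UNIV. \<Sum>j\<in>UNIV. x $ i * Adj $ i $ j * (x $ i - x $ j))
      + (\<Sum>i\<in>UNIV. \<Sum>j\<in>UNIV. x $ j * Adj $ i $ j * (x $ j - x $ i))"
    using * by linarith
  also have "\<dots> = (\<Sum>i\<in>UNIV. \<Sum>j\<in>UNIV. Adj $ i $ j * (x $ i - x $ j)\<^sup>2)"
    unfolding sum.distrib[symmetric]
    by (intro sum.cong refl) (simp add: power2_eq_square algebra_simps)
  finally show ?thesis .
qed

text \<open>A vanishing quadratic form forces equal values across every edge, and paths carry the
  equality to all pairs of nodes.\<close>

lemma laplacian_kernel:
  assumes g: "weighted_graph Adj" and conn: "connected_graph Adj" and 0: "laplacian Adj *v x = 0"
  shows "x $ i = x $ j"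
proof -
  have nn: "0 \<le> Adj $ i $ j" for i j
    using g by (simp add: weighted_graph_def)
  have "(\<Sum>i\<in>UNIV. \<Sum>j\<in>UNIV. Adj $ i $ j * (x $ i - x $ j)\<^sup>2) = 0"
    using laplacian_quadratic_form[OF g, of x] 0 by simp
  then have "\<forall>i\<in>UNIV. \<forall>j\<in>UNIV. Adj $ i $ j * (x $ i - x $ j)\<^sup>2 = 0"
    by (simp add: sum_nonneg_eq_0_iff sum_nonneg nn del: mult_eq_0_iff)
  then have edge: "x $ i = x $ j" if "0 < Adj $ i $ j" for i j
    using that by (metis UNIV_I eq_iff_diff_eq_0 less_irrefl mult_eq_0_iff zero_eq_power2)
  have "(i, j) \<in> {(i, j). 0 < Adj $ i $ j}\<^sup>*"
    using conn by (simp add: connected_graph_def)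
  then show ?thesis
    by (induction rule: rtrancl_induct) (auto dest: edge)
qed

text \<open>Reconciles the sorted list \<open>lam\<close> with an unsorted eigenbasis. Connectivity
  makes the eigenvalue 0 simple, so all modes but \<open>i0\<close> have eigenvalues between
  \<open>lam 2\<close> and the last entry, and \<open>lam 2\<close> is positive.\<close>

lemma laplacian_spectrum:
  fixes Adj :: "real^'N^'N"
  assumes g: "weighted_graph Adj" and conn: "connected_graph Adj"
    and lam: "ordered_eigenvalues (laplacian Adj) lam" and card: "CARD('N) \<ge> 2"
  shows "\<exists>(v :: 'N \<Rightarrow> real^'N) \<mu> i0. (\<forall>i j. v i \<bullet> v j = (if i = j then 1 else 0))
    \<and> (\<forall>i. laplacian Adj *v v i = \<mu> i *\<^sub>R v i) \<and> \<mu> i0 = 0 \<and> (\<forall>j k. v i0 $ j = v i0 $ k)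
    \<and> (\<forall>i. i \<noteq> i0 \<longrightarrow> lam 2 \<le> \<mu> i \<and> \<mu> i \<le> lam CARD('N)) \<and> 0 < lam 2"
proof -
  let ?L = "laplacian Adj"
  let ?N = "CARD('N)"
  obtain v :: "'N \<Rightarrow> real^'N" and \<mu> where v: "\<And>i j. v i \<bullet> v j = (if i = j then 1 else 0)"
    and ev: "\<And>i. ?L *v v i = \<mu> i *\<^sub>R v i"
    using symmetric_orthonormal_eigenbasis[OF transpose_laplacian[OF g]] by metis
  have \<mu>: "\<mu> i = v i \<bullet> (?L *v v i)" for i
    by (simp add: ev v)
  have \<mu>0: "0 \<le> \<mu> i" for i
    using laplacian_quadratic_form[OF g, of "v i"] g
    by (simp add: \<mu>[symmetric]) (smt (verit) mult_nonneg_nonneg sum_nonneg weighted_graph_def zero_le_power2)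
  \<comment> \<open>The all-ones vector lies in the kernel. By symmetry, an eigenvector not
    orthogonal to it has eigenvalue 0, and such an eigenvector supplies \<open>i0\<close>.\<close>
  define one :: "real^'N" where "one = vec 1"
  have "?L *v one = 0"
    by (simp add: vec_eq_iff laplacian_mult_component one_def)
  have "one \<noteq> 0"
    by (simp add: one_def vec_eq_iff)
  moreover have "one = (\<Sum>i\<in>UNIV. (v i \<bullet> one) *\<^sub>R v i)"
    using v by (rule orthonormal_expansion(2))
  ultimately obtain i0 where i0: "v i0 \<bullet> one \<noteq> 0"
    by (metis (mono_tags, lifting) scale_eq_0_iff sum.neutral)
  have "\<mu> i0 * (v i0 \<bullet> one) = v i0 \<bullet> (?L *v one)"
    by (simp add: inner_symmetric_mult[OF transpose_laplacian[OF g]] ev)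
  then have \<mu>i0: "\<mu> i0 = 0"
    using i0 \<open>?L *v one = 0\<close> by simp
  have const: "v i $ j = v i $ k" if "\<mu> i = 0" for i j k
    using laplacian_kernel[OF g conn, of "v i"] that by (simp add: ev)
  \<comment> \<open>A second null eigenvector would be constant as well, and two constant unit
    vectors are not orthogonal.\<close>
  have pos: "0 < \<mu> i" if "i \<noteq> i0" for i
  proof (rule ccontr)
    assume "\<not> 0 < \<mu> i"
    then have "\<mu> i = 0"
      using \<mu>0[of i] by simp
    obtain a where a: "\<And>j. v i $ j = a"
      using const[OF \<open>\<mu> i = 0\<close>] by metis
    obtain b where b: "\<And>j. v i0 $ j = b"
      using const[OF \<mu>i0] by metis
    have "v i \<bullet> v i0 = 0" "v i \<bullet> v i = 1" "v i0 \<bullet> v i0 = 1"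
      using that by (auto simp: v)
    then show False
      by (simp add: inner_vec_def a b) auto
  qed
  have mono: "mono_on {1..?N} lam" and det: "\<And>s. det (mat s - ?L) = (\<Prod>k=1..?N. s - lam k)"
    using lam by (auto simp: ordered_eigenvalues_def)
  have prods: "(\<Prod>i\<in>UNIV. s - \<mu> i) = (\<Prod>k=1..?N. s - lam k)" for s
    using det_eigenbasis[OF v ev] det by metis
  \<comment> \<open>Evaluating one factorization of the characteristic polynomial at a root of the
    other matches the two families of eigenvalues as sets.\<close>
  have ex_lam: "\<exists>k\<in>{1..?N}. lam k = \<mu> i" for i
  proof -
    have "(\<Prod>j\<in>UNIV. \<mu> i - \<mu> j) = 0"
      by (rule prod_zero) auto
    then have "(\<Prod>k=1..?N. \<mu> i - lam k) = 0"
      by (simp only: prods)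
    then show ?thesis
      by (auto simp: prod_zero_iff)
  qed
  have ex_\<mu>: "\<exists>i. lam k = \<mu> i" if "k \<in> {1..?N}" for k
  proof -
    have "(\<Prod>l=1..?N. lam k - lam l) = 0"
      using that by (intro prod_zero) auto
    then have "(\<Prod>j\<in>UNIV. lam k - \<mu> j) = 0"
      by (simp only: prods)
    then show ?thesis
      by (auto simp: prod_zero_iff)
  qed
  have lam1: "lam 1 = 0"
  proof -
    obtain k where "k \<in> {1..?N}" "lam k = 0"
      using ex_lam[of i0] \<mu>i0 by auto
    then have "lam 1 \<le> 0"
      using mono_onD[OF mono, of 1 k] by auto
    moreover obtain i where "lam 1 = \<mu> i"
      using ex_\<mu>[of 1] card by auto
    ultimately show ?thesis
      using \<mu>0[of i] by simp
  qed
  have "lam 2 \<noteq> 0"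
  proof
    assume lam2: "lam 2 = 0"
    \<comment> \<open>If \<open>lam 2 = 0\<close>, the polynomial vanishes at 0 to second order on
      one side and only to first order on the other. Cancelling one factor \<open>s\<close> is valid
      for nonzero \<open>s\<close>; the limit at 0 then gives the contradiction.\<close>
    let ?f = "\<lambda>s. \<Prod>i\<in>UNIV - {i0}. s - \<mu> i"
    let ?g = "\<lambda>s. s * (\<Prod>k=3..?N. s - lam k)"
    have eq: "?f s = ?g s" if "s \<noteq> 0" for s
    proof -
      have "s * ?f s = (\<Prod>i\<in>UNIV. s - \<mu> i)"
        using \<mu>i0 by (subst prod.remove[of UNIV i0]) auto
      also have "\<dots> = (\<Prod>k=1..?N. s - lam k)"
        by (rule prods)
      also have "{1..?N} = insert 1 (insert 2 {3..?N})"
        using card by auto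
      then have "(\<Prod>k=1..?N. s - lam k) = s * ?g s"
        by (simp add: lam1 lam2 del: One_nat_def)
      finally show ?thesis
        using that by simp
    qed
    have f: "?f \<midarrow>0\<rightarrow> ?f 0" and g: "?g \<midarrow>0\<rightarrow> ?g 0"
      by (intro tendsto_intros)+
    have "?f \<midarrow>0\<rightarrow> ?g 0"
      by (rule iffD2[OF LIM_equal g]) (use eq in auto)
    then have "?f 0 = ?g 0"
      by (rule LIM_unique[OF f])
    then have "?f 0 = 0"
      by simp
    then show False
      using pos by (auto simp: prod_zero_iff less_le)
  qed
  moreover have "0 \<le> lam 2"
    using ex_\<mu>[of 2] \<mu>0 card by force
  moreover have "lam 2 \<le> \<mu> i \<and> \<mu> i \<le> lam ?N" if "i \<noteq> i0" for i
  proof -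
    obtain k where k: "k \<in> {1..?N}" "lam k = \<mu> i"
      using ex_lam by blast
    then have "k \<noteq> 1"
      using pos[OF that] lam1 by auto
    then show ?thesis
      using k mono_onD[OF mono, of 2 k] mono_onD[OF mono, of k ?N] by auto
  qed
  ultimately show ?thesis
    by (intro exI[of _ v] exI[of _ \<mu>] exI[of _ i0] conjI allI impI v ev \<mu>i0 const) (auto simp: less_le)
qed

section \<open>The matrix exponential\<close>

lemma mat_power_Suc: "mat_power M (Suc k) = M ** mat_power M k"
  by (simp add: mat_power_def)

lemma mat_power_0: "mat_power M 0 = mat 1"
  by (simp add: mat_power_def)

lemma mat_power_scaleR: "mat_power (t *\<^sub>R M) k = t ^ k *\<^sub>R mat_power M k"
  by (induction k) (simp_all add: mat_power_0 mat_power_Suc matrix_scaleR_left matrix_scaleR_right)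

lemma mat_power_intertwine:
  assumes "M ** X = X ** (M' :: real^'m^'m)"
  shows "mat_power M k ** X = X ** mat_power M' k"
proof (induction k)
  case (Suc k)
  then show ?case
    using assms by (metis mat_power_Suc matrix_mul_assoc)
qed (simp add: mat_power_0)

lemma mat_power_component_bound:
  fixes M :: "real^'n^'n"
  shows "\<exists>K. \<forall>i j k. \<bar>mat_power M k $ i $ j\<bar> \<le> K ^ k"
proof -
  obtain K where K: "K > 0" "\<And>x. norm (M *v x) \<le> K * norm x"
    using mult_norm_le by metis
  have nrm: "norm (mat_power M k *v x) \<le> K ^ k * norm x" for k x
  proof (induction k)
    case (Suc k)
    have "norm (M *v (mat_power M k *v x)) \<le> K * (K ^ k * norm x)"
      using K Suc by (meson less_imp_le mult_left_mono order_trans)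
    then show ?case
      by (simp add: mat_power_Suc matrix_vector_mul_assoc)
  qed (simp add: mat_power_0)
  have "\<bar>mat_power M k $ i $ j\<bar> \<le> K ^ k" for i j k
  proof -
    have "mat_power M k $ i $ j = (mat_power M k *v axis j 1) $ i"
      by (simp add: matrix_vector_mult_basis column_def)
    also have "\<bar>\<dots>\<bar> \<le> norm (mat_power M k *v axis j 1)"
      by (rule component_le_norm_cart)
    finally show ?thesis
      using nrm[of k "axis j 1"] by simp
  qed
  then show ?thesis by blast
qed

text \<open>An operator norm constant bounds the entries of the powers geometrically, so a real
  exponential series majorizes.\<close>

lemma mat_exp_component_summable:
  "summable (\<lambda>k. mat_power M k $ i $ j / fact k * t ^ k)"
proof -
  obtain K where K: "\<And>i j k. \<bar>mat_power M k $ i $ j\<bar> \<le> K ^ k"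
    using mat_power_component_bound by metis
  show ?thesis
  proof (rule summable_comparison_test')
    show "summable (\<lambda>k. (K * \<bar>t\<bar>) ^ k /\<^sub>R fact k)"
      by (rule summable_exp_generic)
    show "norm (mat_power M k $ i $ j / fact k * t ^ k) \<le> (K * \<bar>t\<bar>) ^ k /\<^sub>R fact k" if "k \<ge> 0" for k
      using mult_right_mono[OF K[of k i j], of "\<bar>t\<bar> ^ k"]
      by (simp add: abs_mult power_abs power_mult_distrib field_simps)
  qed
qed

text \<open>Entrywise convergence yields convergence of the matrices, so the infinite sum defining
  \<open>mat_exp\<close> is a true limit and not a default value.\<close>

lemma mat_exp_component_sums:
  "(\<lambda>k. mat_power M k $ i $ j / fact k) sums (mat_exp M $ i $ j)"
proof -
  have c: "(\<lambda>k. mat_power M k $ i $ j / fact k) sums (\<Sum>k. mat_power M k $ i $ j / fact k)" for i j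
    using mat_exp_component_summable[of M i j 1] by (simp add: summable_sums)
  have "(\<lambda>k. mat_power M k /\<^sub>R fact k) sums (\<chi> i j. \<Sum>k. mat_power M k $ i $ j / fact k)"
    unfolding sums_def
    by (intro vec_tendstoI) (use c in \<open>simp add: sums_def divide_inverse mult.commute\<close>)
  then have "mat_exp M = (\<chi> i j. \<Sum>k. mat_power M k $ i $ j / fact k)"
    by (simp add: mat_exp_def sums_iff)
  then show ?thesis
    using c by simp
qed

lemma mat_exp_scaleR_component:
  "mat_exp (t *\<^sub>R M) $ i $ j = (\<Sum>k. mat_power M k $ i $ j / fact k * t ^ k)"
  using mat_exp_component_sums[of "t *\<^sub>R M" i j] by (simp add: mat_power_scaleR sums_iff mult.commute)

lemma mat_exp_0: "mat_exp (0 *\<^sub>R M) = mat 1"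
proof -
  have "(\<Sum>k. mat_power M k $ i $ j / fact k * 0 ^ k) = mat_power M 0 $ i $ j" for i j
    using powser_zero[of "\<lambda>k. mat_power M k $ i $ j / fact k"] by simp
  then show ?thesis
    by (simp add: vec_eq_iff mat_exp_scaleR_component mat_power_0 del: scaleR_zero_left)
qed

text \<open>Carries an invariance relation from the generator to the flow. \<open>X\<close> may be
  rectangular, so it can parametrize an invariant subspace.\<close>

lemma mat_exp_intertwine:
  fixes X :: "real^'m^'n"
  assumes "M ** X = X ** M'"
  shows "mat_exp M ** X = X ** mat_exp M'"
proof -
  have "(mat_exp M ** X) $ i $ j = (X ** mat_exp M') $ i $ j" for i j
  proof (rule sums_unique2)
    have "(\<lambda>k. \<Sum>l\<in>UNIV. mat_power M k $ i $ l / fact k * X $ l $ j) sums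
        (\<Sum>l\<in>UNIV. mat_exp M $ i $ l * X $ l $ j)"
      by (intro sums_sum sums_mult2 mat_exp_component_sums)
    then show "(\<lambda>k. (mat_power M k ** X) $ i $ j / fact k) sums ((mat_exp M ** X) $ i $ j)"
      by (simp add: matrix_matrix_mult_def sum_divide_distrib)
    have "(\<lambda>k. \<Sum>l\<in>UNIV. X $ i $ l * (mat_power M' k $ l $ j / fact k)) sums
        (\<Sum>l\<in>UNIV. X $ i $ l * mat_exp M' $ l $ j)"
      by (intro sums_sum sums_mult mat_exp_component_sums)
    then have "(\<lambda>k. (X ** mat_power M' k) $ i $ j / fact k) sums ((X ** mat_exp M') $ i $ j)"
      by (simp add: matrix_matrix_mult_def sum_divide_distrib)
    then show "(\<lambda>k. (mat_power M k ** X) $ i $ j / fact k) sums ((X ** mat_exp M') $ i $ j)"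
      by (simp add: mat_power_intertwine[OF assms])
  qed
  then show ?thesis
    by (simp add: vec_eq_iff)
qed

lemma mat_exp_intertwine_scaleR:
  fixes X :: "real^'m^'n"
  assumes "M ** X = X ** M'"
  shows "mat_exp (t *\<^sub>R M) ** X = X ** mat_exp (t *\<^sub>R M')"
  by (rule mat_exp_intertwine) (simp add: matrix_scaleR_left matrix_scaleR_right assms)

lemma mat_exp_component_deriv:
  "((\<lambda>t. mat_exp (t *\<^sub>R M) $ i $ j) has_real_derivative (M ** mat_exp (t *\<^sub>R M)) $ i $ j) (at t)"
proof -
  let ?c = "\<lambda>i j k. mat_power M k $ i $ j / fact k"
  have "((\<lambda>t. \<Sum>k. ?c i j k * t ^ k) has_field_derivative (\<Sum>k. diffs (?c i j) k * t ^ k)) (at t)"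
    by (rule termdiffs_strong_converges_everywhere) (rule mat_exp_component_summable)
  moreover have "(\<Sum>k. diffs (?c i j) k * t ^ k) = (M ** mat_exp (t *\<^sub>R M)) $ i $ j"
  proof -
    have "diffs (?c i j) k = (\<Sum>l\<in>UNIV. M $ i $ l * ?c l j k)" for k
    proof -
      \<comment> \<open>The factor \<open>k + 1\<close> from differentiation turns
        \<open>fact (Suc k)\<close> into \<open>fact k\<close>.\<close>
      have "diffs (?c i j) k = mat_power M (Suc k) $ i $ j / fact k"
        by (simp add: diffs_def fact_Suc del: of_nat_Suc)
      then show ?thesis
        by (simp add: mat_power_Suc matrix_matrix_mult_def sum_divide_distrib)
    qed
    then have "(\<lambda>k. diffs (?c i j) k * t ^ k) = (\<lambda>k. \<Sum>l\<in>UNIV. M $ i $ l * (?c l j k * t ^ k))"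
      by (simp add: sum_distrib_right mult.assoc)
    moreover have "(\<lambda>k. \<Sum>l\<in>UNIV. M $ i $ l * (?c l j k * t ^ k)) sums
        (\<Sum>l\<in>UNIV. M $ i $ l * (\<Sum>k. ?c l j k * t ^ k))"
      by (intro sums_sum sums_mult summable_sums mat_exp_component_summable)
    ultimately show ?thesis
      by (simp add: sums_iff mat_exp_scaleR_component matrix_matrix_mult_def)
  qed
  ultimately show ?thesis
    by (simp add: mat_exp_scaleR_component)
qed

lemma matrix_has_vector_derivativeI:
  fixes f :: "real \<Rightarrow> real^'n^'m"
  assumes "\<And>i j. ((\<lambda>t. f t $ i $ j) has_real_derivative D $ i $ j) (at t)"
  shows "(f has_vector_derivative D) (at t)"
proof -
  have "((\<lambda>t. f t $ i) has_vector_derivative D $ i) (at t)" for i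
    using assms by (subst has_vector_derivative_vec_iff) (simp add: has_real_derivative_iff_has_vector_derivative)
  then have "((\<lambda>t. f t \<bullet> b) has_derivative (\<lambda>s. (s *\<^sub>R D) \<bullet> b)) (at t)" if b: "b \<in> Basis" for b
  proof -
    obtain i c where b: "b = axis i c" "c \<in> Basis"
      using b by (auto simp: Basis_vec_def)
    have "((\<lambda>t. f t $ i) has_derivative (\<lambda>s. s *\<^sub>R D $ i)) (at t)"
      using \<open>\<And>i. ((\<lambda>t. f t $ i) has_vector_derivative _) _\<close> by (simp add: has_vector_derivative_def)
    from has_derivative_inner_left[OF this, of c] show ?thesis
      by (simp add: b inner_axis)
  qed
  then show ?thesis
    unfolding has_vector_derivative_def by (subst has_derivative_componentwise_within) auto
qed

lemma mat_exp_has_vector_derivative: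
  "((\<lambda>t. mat_exp (t *\<^sub>R M)) has_vector_derivative (M ** mat_exp (t *\<^sub>R M))) (at t)"
  by (rule matrix_has_vector_derivativeI) (rule mat_exp_component_deriv)

section \<open>Cost of an observer-based loop\<close>

text \<open>\<open>V\<close> is a storage function: an antiderivative \<open>F\<close> of
  \<open>f\<close> plus \<open>V\<close> does not increase, so the increasing \<open>F\<close> is
  bounded and has a limit. The integral is then evaluated by \<open>F\<close>, which gives
  finiteness and the bound at once.\<close>

lemma nn_integral_dissipation:
  fixes f V V' :: "real \<Rightarrow> real"
  assumes cont: "\<And>t. isCont f t" and f0: "\<And>t. 0 \<le> f t"
    and V: "\<And>t. 0 \<le> t \<Longrightarrow> (V has_real_derivative V' t) (at t)"
    and diss: "\<And>t. 0 \<le> t \<Longrightarrow> f t \<le> - V' t" and V0: "\<And>t. 0 \<le> t \<Longrightarrow> 0 \<le> V t"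
  shows "(\<integral>\<^sup>+ t\<in>{0..}. ennreal (f t) \<partial>lborel) \<le> ennreal (V 0)"
proof -
  obtain F where F: "\<And>t. (F has_vector_derivative f t) (at t)"
    using einterval_antiderivative[of "-\<infinity>" "\<infinity>" f] cont by auto
  then have F': "(F has_real_derivative f t) (at t)" for t
    by (simp add: has_real_derivative_iff_has_vector_derivative)
  have mono: "F s \<le> F t" if "s \<le> t" for s t
    by (rule DERIV_nonneg_imp_nondecreasing[OF that]) (use F' f0 in blast)
  have bound: "F t \<le> F 0 + V 0" if "0 \<le> t" for t
  proof -
    have "F t + V t \<le> F 0 + V 0"
    proof (rule DERIV_nonpos_imp_nonincreasing[OF that])
      fix s assume "0 \<le> s" "s \<le> t"
      then show "\<exists>y. ((\<lambda>t. F t + V t) has_real_derivative y) (at s) \<and> y \<le> 0"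
        using DERIV_add[OF F'[of s] V[of s]] diss[of s] by fastforce
    qed
    then show ?thesis
      using V0[OF that] by simp
  qed
  define l where "l = (SUP t\<in>{0..}. F t)"
  have bdd: "bdd_above (F ` {0..})"
    using bound by (auto simp: bdd_above_def)
  have "(F \<longlongrightarrow> l) at_top"
  proof (rule increasing_tendsto)
    show "\<forall>\<^sub>F t in at_top. F t \<le> l"
      using eventually_ge_at_top[of 0] by eventually_elim (auto simp: l_def intro!: cSUP_upper bdd)
    fix x assume "x < l"
    then obtain s where s: "0 \<le> s" "x < F s"
      using less_cSUP_iff[OF _ bdd, of x] by (auto simp: l_def)
    show "\<forall>\<^sub>F t in at_top. x < F t"
      using eventually_ge_at_top[of s] by eventually_elim (use s mono in force)
  qed
  moreover have "continuous_on UNIV f"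
    using cont by (simp add: continuous_at_imp_continuous_on)
  ultimately have "(\<integral>\<^sup>+ t\<in>{0..}. ennreal (f t) \<partial>lborel) = ennreal (l - F 0)"
    by (intro nn_integral_FTC_atLeast F' f0 borel_measurable_continuous_onI)
  also have "l \<le> F 0 + V 0"
    unfolding l_def by (rule cSUP_least) (auto intro: bound)
  then have "ennreal (l - F 0) \<le> ennreal (V 0)"
    by (intro ennreal_leI) simp
  finally show ?thesis .
qed

lemma matrix_row_mult:
  fixes M :: "real^'n^'m"
  shows "(M ** N) $ i = transpose N *v (M $ i)"
  by (simp add: matrix_matrix_mult_def matrix_vector_mult_def transpose_def vec_eq_iff mult.commute)

text \<open>The squared Frobenius norm. It is summed over rows because rows of the impulse response
  evolve by the transposed dynamics; \<open>frob_sq_transpose\<close> switches to columns.\<close>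

definition frob_sq :: "real^'n^'m \<Rightarrow> real" where
  "frob_sq M = (\<Sum>i\<in>UNIV. M $ i \<bullet> M $ i)"

lemma frob_sq_nonneg: "0 \<le> frob_sq M"
  by (simp add: frob_sq_def sum_nonneg)

lemma trace_transpose_mult_self: "trace (transpose M ** M) = frob_sq M"
  unfolding trace_def frob_sq_def matrix_matrix_mult_def transpose_def inner_vec_def
  by simp (rule sum.swap)

lemma frob_sq_transpose: "frob_sq (transpose M) = frob_sq M"
  unfolding frob_sq_def transpose_def inner_vec_def by simp (rule sum.swap)

lemma weighted_trace: "trace (C ** S ** transpose C) = (\<Sum>z\<in>UNIV. C $ z \<bullet> (S *v C $ z))"
proof -
  have "trace (C ** S ** transpose C) = (\<Sum>z\<in>UNIV. (C ** (S ** transpose C)) $ z $ z)"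
    by (simp add: trace_def matrix_mul_assoc)
  also have "\<dots> = (\<Sum>z\<in>UNIV. C $ z \<bullet> (S *v C $ z))"
    by (intro sum.cong refl)
      (simp add: matrix_row_mult matrix_transpose_mul inner_vec_def matrix_matrix_mult_def
        matrix_vector_mult_def transpose_def sum_distrib_left mult_ac)
  finally show ?thesis .
qed

lemma weighted_trace_derivative:
  fixes \<Phi> :: "real \<Rightarrow> real^'n^'z"
  assumes S: "transpose S = S" and d: "(\<Phi> has_vector_derivative D) (at t)"
  shows "((\<lambda>t. \<Sum>z\<in>UNIV. \<Phi> t $ z \<bullet> (S *v \<Phi> t $ z)) has_real_derivative
    (\<Sum>z\<in>UNIV. 2 * (D $ z \<bullet> (S *v \<Phi> t $ z)))) (at t)"
proof -
  have "((\<lambda>t. \<Phi> t $ z \<bullet> (S *v \<Phi> t $ z)) has_real_derivative 2 * (D $ z \<bullet> (S *v \<Phi> t $ z))) (at t)" for z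
  proof -
    have "((\<lambda>t. \<Phi> t $ z) has_vector_derivative D $ z) (at t)"
      by (rule bounded_linear.has_vector_derivative[OF bounded_linear_vec_nth d])
    then have "((\<lambda>t. \<Phi> t $ z \<bullet> (S *v \<Phi> t $ z)) has_vector_derivative
        \<Phi> t $ z \<bullet> (S *v D $ z) + D $ z \<bullet> (S *v \<Phi> t $ z)) (at t)"
      by (intro bounded_bilinear.has_vector_derivative[OF bounded_bilinear_inner]
          bounded_linear.has_vector_derivative[OF matrix_vector_mul_bounded_linear])
    moreover have "\<Phi> t $ z \<bullet> (S *v D $ z) = D $ z \<bullet> (S *v \<Phi> t $ z)"
      by (subst inner_symmetric_mult[OF S]) (rule inner_commute)
    ultimately show ?thesis
      by (simp add: has_real_derivative_iff_has_vector_derivative)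
  qed
  then show ?thesis
    by (rule DERIV_sum)
qed

text \<open>With \<open>g\<close> as below, \<open>out\<close> is the sum of the orthogonal vectors
  \<open>transpose E *v p\<close> and \<open>transpose D1 *v g\<close>, the latter as long as
  \<open>g\<close>. The inequality for \<open>Q\<close> then bounds the left-hand side by the square
  of \<open>g + transpose G *v p\<close>, which is \<open>transpose G *v r\<close>.\<close>

lemma observer_dissipation:
  fixes A :: "real^'n^'n" and E :: "real^'q^'n" and C1 :: "real^'n^'r" and D1 :: "real^'q^'r"
    and p r :: "real^'n"
  assumes D1E: "D1 ** transpose E = 0" and D1D1: "D1 ** transpose D1 = mat 1"
    and Q: "transpose Q = Q"
    and ric: "neg_def (A ** Q + Q ** transpose A - Q ** transpose C1 ** C1 ** Q + E ** transpose E)"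
    and G: "G = Q ** transpose C1"
  defines "out \<equiv> transpose (E - G ** D1) *v p + transpose (G ** D1) *v r"
    and "p' \<equiv> transpose (A - G ** C1) *v p + transpose (G ** C1) *v r"
  shows "out \<bullet> out + 2 * (p' \<bullet> (Q *v p)) \<le> (transpose G *v r) \<bullet> (transpose G *v r)"
proof -
  define g where "g = transpose G *v (r - p)"
  have GT: "transpose G = C1 ** Q"
    by (simp add: G matrix_transpose_mul Q)
  have out: "out = transpose E *v p + transpose D1 *v g"
    by (simp add: out_def g_def transpose_diff matrix_transpose_mul matrix_vector_expand)
  have p': "p' = transpose A *v p + transpose C1 *v g"
    by (simp add: p'_def g_def transpose_diff matrix_transpose_mul matrix_vector_expand)
  have "(transpose E *v p) \<bullet> (transpose D1 *v g) = (D1 *v (transpose E *v p)) \<bullet> g"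
    by (rule inner_transpose_mult)
  then have ED: "(transpose E *v p) \<bullet> (transpose D1 *v g) = 0"
    by (simp add: matrix_vector_mul_assoc D1E)
  have "(transpose D1 *v g) \<bullet> (transpose D1 *v g) = (D1 *v (transpose D1 *v g)) \<bullet> g"
    by (rule inner_transpose_mult)
  then have DD: "(transpose D1 *v g) \<bullet> (transpose D1 *v g) = g \<bullet> g"
    by (simp add: matrix_vector_mul_assoc D1D1)
  have outsq: "out \<bullet> out = (transpose E *v p) \<bullet> (transpose E *v p) + g \<bullet> g"
    using ED DD by (simp add: out inner_add_left inner_add_right inner_commute)
  have "(transpose C1 *v g) \<bullet> (Q *v p) = g \<bullet> (transpose G *v p)"
    by (metis GT inner_commute inner_transpose_mult matrix_vector_mul_assoc)
  then have p'Q: "p' \<bullet> (Q *v p) = (transpose A *v p) \<bullet> (Q *v p) + g \<bullet> (transpose G *v p)"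
    by (simp add: p' inner_add_left)
  have g: "g = transpose G *v r - transpose G *v p"
    by (simp add: g_def matrix_vector_expand)
  have "p \<bullet> ((A ** Q + Q ** transpose A - Q ** transpose C1 ** C1 ** Q + E ** transpose E) *v p)
      = 2 * ((transpose A *v p) \<bullet> (Q *v p)) - (transpose G *v p) \<bullet> (transpose G *v p)
        + (transpose E *v p) \<bullet> (transpose E *v p)"
  proof -
    have "p \<bullet> (A *v (Q *v p)) = (transpose A *v p) \<bullet> (Q *v p)"
      using inner_transpose_mult[of p "transpose A" "Q *v p"] by simp
    moreover have "p \<bullet> (Q *v (transpose A *v p)) = (transpose A *v p) \<bullet> (Q *v p)"
      by (subst inner_symmetric_mult[OF Q]) (rule inner_commute)
    moreover have "p \<bullet> (Q *v (transpose C1 *v (C1 *v (Q *v p)))) = (transpose G *v p) \<bullet> (transpose G *v p)"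
      by (subst inner_symmetric_mult[OF Q])
        (simp add: inner_transpose_mult GT matrix_vector_mul_assoc[symmetric])
    moreover have "p \<bullet> (E *v (transpose E *v p)) = (transpose E *v p) \<bullet> (transpose E *v p)"
      using inner_transpose_mult[of p "transpose E" "transpose E *v p"] by simp
    ultimately show ?thesis
      by (simp add: matrix_vector_expand inner_add_right inner_diff_right)
  qed
  moreover have "p \<bullet> ((A ** Q + Q ** transpose A - Q ** transpose C1 ** C1 ** Q + E ** transpose E) *v p) \<le> 0"
    using ric by (cases "p = 0") (auto simp: neg_def_def less_imp_le)
  ultimately show ?thesis
    unfolding outsq p'Q by (simp add: g inner_diff_left inner_diff_right inner_commute)
qed

text \<open>The storage function is the \<open>Q\<close>-form of the rows of \<open>\<Phi>\<close>
  plus \<open>V\<close>. Here \<open>V\<close> is left abstract and only pays for the energy of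
  \<open>\<Psi> t ** G\<close>, because it will come from the columns.\<close>

lemma observer_cost:
  fixes A :: "real^'n^'n" and E :: "real^'q^'n" and C1 :: "real^'n^'r" and D1 :: "real^'q^'r"
    and \<Phi> \<Psi> :: "real \<Rightarrow> real^'n^'z"
  assumes D1E: "D1 ** transpose E = 0" and D1D1: "D1 ** transpose D1 = mat 1"
    and Q: "pos_def Q"
    and ric: "neg_def (A ** Q + Q ** transpose A - Q ** transpose C1 ** C1 ** Q + E ** transpose E)"
    and G: "G = Q ** transpose C1"
    and d\<Phi>: "\<And>t. (\<Phi> has_vector_derivative (\<Phi> t ** (A - G ** C1) + \<Psi> t ** (G ** C1))) (at t)"
    and \<Psi>: "\<And>t. isCont \<Psi> t"
    and V: "\<And>t. 0 \<le> t \<Longrightarrow> (V has_real_derivative V' t) (at t)"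
    and diss: "\<And>t. 0 \<le> t \<Longrightarrow> frob_sq (\<Psi> t ** G) \<le> - V' t" and V0: "\<And>t. 0 \<le> t \<Longrightarrow> 0 \<le> V t"
  defines "T \<equiv> \<lambda>t. \<Phi> t ** (E - G ** D1) + \<Psi> t ** (G ** D1)"
  shows "(\<integral>\<^sup>+ t\<in>{0..}. ennreal (frob_sq (T t)) \<partial>lborel)
    \<le> ennreal (trace (\<Phi> 0 ** Q ** transpose (\<Phi> 0)) + V 0)"
proof -
  have symQ: "transpose Q = Q"
    using Q by (simp add: pos_def_def)
  define p' where "p' t z = transpose (A - G ** C1) *v (\<Phi> t $ z) + transpose (G ** C1) *v (\<Psi> t $ z)" for t z
  define W where "W t = (\<Sum>z\<in>UNIV. \<Phi> t $ z \<bullet> (Q *v \<Phi> t $ z)) + V t" for t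
  define W' where "W' t = (\<Sum>z\<in>UNIV. 2 * (p' t z \<bullet> (Q *v \<Phi> t $ z))) + V' t" for t
  have "(\<integral>\<^sup>+ t\<in>{0..}. ennreal (frob_sq (T t)) \<partial>lborel) \<le> ennreal (W 0)"
  proof (rule nn_integral_dissipation[where V' = W'])
    have "isCont \<Phi> t" for t
      using d\<Phi> has_vector_derivative_continuous by blast
    then show "isCont (\<lambda>t. frob_sq (T t)) t" for t
      using \<Psi> unfolding frob_sq_def T_def matrix_matrix_mult_def inner_vec_def
      by (auto intro!: continuous_intros)
    show "(W has_real_derivative W' t) (at t)" if "0 \<le> t" for t
      using DERIV_add[OF weighted_trace_derivative[OF symQ d\<Phi>[of t]] V[OF that]]
      by (simp add: W_def[abs_def] W'_def p'_def matrix_row_mult)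
    show "frob_sq (T t) \<le> - W' t" if "0 \<le> t" for t
    proof -
      have "frob_sq (T t) + (\<Sum>z\<in>UNIV. 2 * (p' t z \<bullet> (Q *v \<Phi> t $ z)))
          \<le> (\<Sum>z\<in>UNIV. (transpose G *v \<Psi> t $ z) \<bullet> (transpose G *v \<Psi> t $ z))"
        unfolding frob_sq_def sum.distrib[symmetric]
        using observer_dissipation[OF D1E D1D1 symQ ric G]
        by (intro sum_mono) (simp add: T_def p'_def matrix_row_mult)
      also have "\<dots> \<le> - V' t"
        using diss[OF that] by (simp add: frob_sq_def matrix_row_mult)
      finally show ?thesis
        by (simp add: W'_def)
    qed
    show "0 \<le> W t" if "0 \<le> t" for t
      using V0[OF that] by (simp add: W_def sum_nonneg pos_def_nonneg[OF Q])
  qed (rule frob_sq_nonneg)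
  then show ?thesis
    by (simp add: W_def weighted_trace)
qed

section \<open>Modes of the network\<close>

text \<open>For \<open>b\<close> as below, \<open>F *v y\<close> is \<open>- c *\<^sub>R b\<close>.
  The feedback contributes \<open>- 2 * c * l\<close> and the input penalty
  \<open>c\<^sup>2 * l ^ 3\<close> times \<open>b \<bullet> b\<close>; the cross terms vanish by
  \<open>D2C2\<close>.\<close>

lemma feedback_dissipation:
  fixes A P :: "real^'n^'n" and B :: "real^'m^'n" and C2 :: "real^'n^'p" and D2 :: "real^'m^'p"
  assumes D2C2: "transpose D2 ** C2 = 0" and D2D2: "transpose D2 ** D2 = mat 1"
    and P: "transpose P = P" and F: "F = (- c) *\<^sub>R (transpose B ** P)"
    and l: "0 \<le> l" "l \<le> lN" and g: "c\<^sup>2 * l ^ 3 - 2 * c * l \<le> g"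
  shows "2 * (((A + l *\<^sub>R (B ** F)) *v y) \<bullet> (P *v y))
      + l * (((C2 + l *\<^sub>R (D2 ** F)) *v y) \<bullet> ((C2 + l *\<^sub>R (D2 ** F)) *v y))
    \<le> y \<bullet> ((transpose A ** P + P ** A + g *\<^sub>R (P ** B ** transpose B ** P)
      + lN *\<^sub>R (transpose C2 ** C2)) *v y)"
proof -
  define b where "b = transpose B *v (P *v y)"
  have Fy: "F *v y = - c *\<^sub>R b"
    unfolding F b_def by (simp only: scaleR_matrix_vector matrix_vector_mul_assoc)
  have BP: "(B *v b) \<bullet> (P *v y) = b \<bullet> b"
    using inner_transpose_mult[of b B "P *v y"] by (simp only: b_def[symmetric])
  have "(D2 *v b) \<bullet> (C2 *v y) = b \<bullet> (transpose D2 *v (C2 *v y))"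
    by (simp add: inner_transpose_mult)
  then have DC: "(D2 *v b) \<bullet> (C2 *v y) = 0" "(C2 *v y) \<bullet> (D2 *v b) = 0"
    by (simp_all add: matrix_vector_mul_assoc D2C2 inner_commute)
  have "(D2 *v b) \<bullet> (D2 *v b) = b \<bullet> (transpose D2 *v (D2 *v b))"
    by (simp add: inner_transpose_mult)
  then have DD: "(D2 *v b) \<bullet> (D2 *v b) = b \<bullet> b"
    by (simp add: matrix_vector_mul_assoc D2D2)
  have PA: "y \<bullet> (P *v (A *v y)) = (A *v y) \<bullet> (P *v y)"
    by (subst inner_symmetric_mult[OF P]) (rule inner_commute)
  have PB: "y \<bullet> (P *v (B *v b)) = b \<bullet> b"
    by (subst inner_symmetric_mult[OF P]) (simp only: inner_commute[of "P *v y"] BP)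
  have "2 * (((A + l *\<^sub>R (B ** F)) *v y) \<bullet> (P *v y))
      + l * (((C2 + l *\<^sub>R (D2 ** F)) *v y) \<bullet> ((C2 + l *\<^sub>R (D2 ** F)) *v y))
    = 2 * ((A *v y) \<bullet> (P *v y)) + (c\<^sup>2 * l ^ 3 - 2 * c * l) * (b \<bullet> b) + l * ((C2 *v y) \<bullet> (C2 *v y))"
    by (simp add: matrix_vector_expand Fy inner_add_left inner_add_right inner_diff_left inner_diff_right
        BP DC DD power2_eq_square power3_eq_cube algebra_simps
        matrix_vector_mult_scaleR[where c = "- c", simplified])
  also have "\<dots> \<le> 2 * ((A *v y) \<bullet> (P *v y)) + g * (b \<bullet> b) + lN * ((C2 *v y) \<bullet> (C2 *v y))"
    using g l by (intro add_mono order_refl mult_right_mono) auto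
  also have "\<dots> = y \<bullet> ((transpose A ** P + P ** A + g *\<^sub>R (P ** B ** transpose B ** P)
      + lN *\<^sub>R (transpose C2 ** C2)) *v y)"
    by (simp add: matrix_vector_expand inner_add_right PA PB b_def[symmetric] inner_transpose_mult)
  finally show ?thesis .
qed

text \<open>The difference of the two sides factors as
  \<open>c * (b - l) * (c * (l\<^sup>2 + l * b + b\<^sup>2) - 2)\<close>, and the last factor is
  smallest at \<open>l = a\<close>.\<close>

lemma cubic_le_at_upper_end:
  fixes l :: real
  assumes "0 < a" "a \<le> l" "l \<le> b" "0 < c" "2 / (a\<^sup>2 + a * b + b\<^sup>2) \<le> c"
  shows "c\<^sup>2 * l ^ 3 - 2 * c * l \<le> c\<^sup>2 * b ^ 3 - 2 * c * b"
proof -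
  have "0 < a\<^sup>2 + a * b + b\<^sup>2"
    using assms by (intro add_pos_pos mult_pos_pos) auto
  then have "2 \<le> c * (a\<^sup>2 + a * b + b\<^sup>2)"
    using assms(5) by (simp add: pos_divide_le_eq)
  also have "\<dots> \<le> c * (l\<^sup>2 + l * b + b\<^sup>2)"
    using assms by (intro mult_left_mono add_mono power_mono mult_right_mono) auto
  finally have "0 \<le> c * (b - l) * (c * (l\<^sup>2 + l * b + b\<^sup>2) - 2)"
    using assms by (intro mult_nonneg_nonneg) auto
  then show ?thesis
    by (simp add: power2_eq_square power3_eq_cube algebra_simps)
qed

text \<open>The difference factors as
  \<open>c * (l - a) * (2 - c * (a\<^sup>2 + a * l + l\<^sup>2))\<close>, and the last factor is
  smallest at \<open>l = b\<close>.\<close>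

lemma cubic_le_at_lower_end:
  fixes l :: real
  assumes "0 < a" "a \<le> l" "l \<le> b" "0 < c" "c < 2 / (a\<^sup>2 + a * b + b\<^sup>2)"
  shows "c\<^sup>2 * l ^ 3 - 2 * c * l \<le> c\<^sup>2 * a ^ 3 - 2 * c * a"
proof -
  have "0 < a\<^sup>2 + a * b + b\<^sup>2"
    using assms by (intro add_pos_pos mult_pos_pos) auto
  have "c * (a\<^sup>2 + a * l + l\<^sup>2) \<le> c * (a\<^sup>2 + a * b + b\<^sup>2)"
    using assms by (intro mult_left_mono add_mono power_mono) auto
  also have "\<dots> \<le> 2"
    using assms(5) \<open>0 < a\<^sup>2 + a * b + b\<^sup>2\<close> by (simp add: pos_less_divide_eq)
  finally have "0 \<le> c * (l - a) * (2 - c * (a\<^sup>2 + a * l + l\<^sup>2))"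
    using assms by (intro mult_nonneg_nonneg) auto
  then show ?thesis
    by (simp add: power2_eq_square power3_eq_cube algebra_simps)
qed

text \<open>Makes the quadratic term of the inequality for \<open>P\<close> negative at either end
  of the spectrum, as solvability requires.\<close>

lemma cubic_negative:
  fixes l :: real
  assumes "0 < l" "l \<le> b" "0 < c" "c < 2 / b\<^sup>2"
  shows "c\<^sup>2 * l ^ 3 - 2 * c * l < 0"
proof -
  have "c * l\<^sup>2 \<le> c * b\<^sup>2"
    using assms by (intro mult_left_mono power_mono) auto
  also have "\<dots> < 2"
    using assms by (simp add: pos_less_divide_eq)
  finally have "c * l * (c * l\<^sup>2 - 2) < 0"
    using assms by (intro mult_pos_neg) auto
  then show ?thesis
    by (simp add: power2_eq_square power3_eq_cube algebra_simps)
qed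

section \<open>Decomposition of the network along Laplacian eigenvectors\<close>

lemma diag_mat_mult: "diag_mat a ** diag_mat b = diag_mat (\<lambda>k. a k * b k)"
proof -
  have "(\<Sum>k\<in>UNIV. (if i = k then a i else 0) * (if k = j then b k else 0))
      = (\<Sum>k\<in>UNIV. if k = i then a i * (if i = j then b i else 0) else 0)" for i j
    by (intro sum.cong) auto
  then show ?thesis
    by (simp add: vec_eq_iff matrix_matrix_mult_def diag_mat_def)
qed

text \<open>The Kronecker product of the column \<open>v\<close> with \<open>M\<close>; the
  one-element column index of \<open>v\<close> is left out.\<close>

definition mode :: "real^'N \<Rightarrow> real^'d^'c \<Rightarrow> real^'d^('N \<times> 'c)" where
  "mode v M = (\<chi> i. v $ fst i *\<^sub>R M $ snd i)"

lemma mode_mult_vec: "mode v M *v y = stack1 (\<lambda>i. v $ i *\<^sub>R (M *v y))"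
  by (simp add: mode_def stack1_def matrix_vector_mult_def vec_eq_iff sum_distrib_left mult.assoc)

definition lift :: "real^'N \<Rightarrow> real^'n^('N \<times> 'n)" where
  "lift v = mode v (mat 1)"

lemma mode_mult_lift: "mode v M *v y = lift v *v (M *v y)"
  by (simp add: lift_def mode_mult_vec)

lemma kron_mult_lift: "(X \<otimes>\<^sub>K Y) *v (lift v *v y) = lift (X *v v) *v (Y *v y)"
  by (simp add: lift_def mode_mult_vec kron_mult_stack1 matrix_vector_mult_scaleR
      matrix_vector_mult_def[of X] scaleR_sum_left)

lemma lift_scaleR: "lift (r *\<^sub>R v) *v y = r *\<^sub>R (lift v *v y)"
  by (simp add: lift_def mode_mult_vec) (simp add: stack1_def vec_eq_iff)

lemma stack2_scaleR: "r *\<^sub>R stack2 a b = stack2 (r *\<^sub>R a) (r *\<^sub>R b)"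
  by (auto simp: stack2_def vec_eq_iff split: sum.split)

lemma stack2_diff: "stack2 a b - stack2 c d = stack2 (a - c) (b - d)"
  by (auto simp: stack2_def vec_eq_iff split: sum.split)

lemma frob_sq_mode: "frob_sq (mode v M ** N) = (v \<bullet> v) * frob_sq (M ** (N :: real^'c^'b))"
proof -
  have "frob_sq (mode v M ** N) = (\<Sum>i\<in>UNIV. \<Sum>a\<in>UNIV. (v $ i)\<^sup>2 * ((M ** N) $ a \<bullet> (M ** N) $ a))"
    unfolding frob_sq_def matrix_row_mult sum.cartesian_product UNIV_Times_UNIV
    by (intro sum.cong) (auto simp: mode_def matrix_vector_mult_scaleR power2_eq_square)
  then show ?thesis
    by (simp add: frob_sq_def inner_vec_def power2_eq_square sum_distrib_left[symmetric] sum_distrib_right)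
qed

lemma trace_mode:
  "trace (mode v M ** S ** transpose (mode v M)) = (v \<bullet> v) * trace (M ** S ** transpose M)"
proof -
  have "trace (mode v M ** S ** transpose (mode v M))
      = (\<Sum>i\<in>UNIV. \<Sum>a\<in>UNIV. (v $ i)\<^sup>2 * (M $ a \<bullet> (S *v M $ a)))"
    unfolding weighted_trace sum.cartesian_product UNIV_Times_UNIV
    by (intro sum.cong) (auto simp: mode_def matrix_vector_mult_scaleR power2_eq_square)
  then show ?thesis
    by (simp add: weighted_trace inner_vec_def[of v] power2_eq_square sum_distrib_left[symmetric] sum_distrib_right)
qed

text \<open>The lifts of an orthonormal basis, side by side, form an orthogonal matrix, so the
  energy splits over the modes. The proof applies Parseval to slices of each row.\<close>

lemma frob_sq_modes:
  fixes v :: "'N \<Rightarrow> real^'N" and T :: "real^('N \<times> 'q::finite)^'z"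
  assumes v: "\<And>i j. v i \<bullet> v j = (if i = j then 1 else 0)"
  shows "frob_sq T = (\<Sum>i\<in>UNIV. frob_sq (T ** lift (v i)))"
proof -
  have parseval: "(\<Sum>i\<in>UNIV. (v i \<bullet> y)\<^sup>2) = y \<bullet> y" for y
  proof -
    have "y \<bullet> y = y \<bullet> (\<Sum>i\<in>UNIV. (v i \<bullet> y) *\<^sub>R v i)"
      using orthonormal_expansion(2)[OF v, of y] by simp
    then show ?thesis
      by (simp add: inner_sum_right power2_eq_square inner_commute)
  qed
  have row: "x \<bullet> x = (\<Sum>i\<in>UNIV. (transpose (lift (v i)) *v x) \<bullet> (transpose (lift (v i)) *v x))"
    for x :: "real^('N \<times> 'q)"
  proof -
    \<comment> \<open>The slice of the row belonging to input channel \<open>b\<close>, indexed by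
      the agents.\<close>
    define y where "y b = (\<chi> j. x $ (j, b))" for b
    have "(transpose (lift (v i)) *v x) $ b = v i \<bullet> y b" for i b
    proof -
      have "(transpose (lift (v i)) *v x) $ b
          = (\<Sum>j\<in>UNIV. \<Sum>a\<in>UNIV. if a = b then v i $ j * x $ (j, a) else 0)"
        unfolding sum.cartesian_product UNIV_Times_UNIV matrix_vector_mult_def transpose_def lift_def mode_def
        by simp (intro sum.cong, auto simp: mat_def)
      then show ?thesis
        by (simp add: inner_vec_def y_def)
    qed
    then have "(\<Sum>i\<in>UNIV. (transpose (lift (v i)) *v x) \<bullet> (transpose (lift (v i)) *v x))
        = (\<Sum>b\<in>UNIV. \<Sum>i\<in>UNIV. (v i \<bullet> y b)\<^sup>2)"
      by (simp add: inner_vec_def[of "transpose _ *v _"] power2_eq_square) (rule sum.swap)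
    also have "\<dots> = (\<Sum>b\<in>UNIV. \<Sum>j\<in>UNIV. (x $ (j, b))\<^sup>2)"
      by (simp add: parseval) (simp add: inner_vec_def y_def power2_eq_square)
    also have "\<dots> = (\<Sum>j\<in>UNIV. \<Sum>b\<in>UNIV. (x $ (j, b))\<^sup>2)"
      by (rule sum.swap)
    also have "\<dots> = x \<bullet> x"
      by (simp add: inner_vec_def power2_eq_square sum.cartesian_product split_def)
    finally show ?thesis ..
  qed
  show ?thesis
    unfolding frob_sq_def matrix_row_mult by (subst row) (rule sum.swap)
qed

text \<open>For an eigenvector \<open>v\<close> with eigenvalue \<open>l\<close>, the range of \<open>embed_y v l\<close> is the invariant subspace
  \<open>w = l x\<close> of the mode, on which the estimation error vanishes; \<open>embed_x v\<close> complements it.\<close>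

definition embed_x :: "real^'N \<Rightarrow> real^'n^('N \<times> 'n + 'N \<times> 'n)" where
  "embed_x v = vcat (lift v) 0"

definition embed_y :: "real^'N \<Rightarrow> real \<Rightarrow> real^'n^('N \<times> 'n + 'N \<times> 'n)" where
  "embed_y v l = vcat (lift v) (l *\<^sub>R lift v)"

lemma embed_x_mult: "embed_x v *v y = stack2 (lift v *v y) 0"
  by (simp add: embed_x_def vcat_mult)

lemma embed_y_mult: "embed_y v l *v y = stack2 (lift v *v y) (l *\<^sub>R (lift v *v y))"
  by (simp add: embed_y_def vcat_mult scaleR_matrix_vector)

context
  fixes Adj :: "real^'N^'N" and v :: "real^'N" and l :: real
  assumes ev: "laplacian Adj *v v = l *\<^sub>R v"
begin

text \<open>Together with \<open>net_A_embed_y\<close> this is the block triangular form of the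
  mode: the error drives the feedback part through \<open>G ** C1\<close> and receives nothing back.
  Multiplying by \<open>l\<close> instead of dividing keeps both relations available for
  \<open>l = 0\<close>.\<close>

lemma net_A_embed_x:
  "net_A Adj A B C1 F G ** embed_x v = embed_x v ** (A - G ** C1) + embed_y v l ** (G ** C1)"
  by (simp add: matrix_eq net_A_def matrix_vector_expand embed_x_mult embed_y_mult vcat_mult
      hcat_mult_stack2 kron_mult_lift ev lift_scaleR stack2_add stack2_diff)

lemma net_A_embed_y:
  "net_A Adj A B C1 F G ** embed_y v l = embed_y v l ** (A + l *\<^sub>R (B ** F))"
  by (simp add: matrix_eq net_A_def matrix_vector_expand embed_y_mult vcat_mult
      hcat_mult_stack2 kron_mult_lift ev lift_scaleR stack2_add stack2_scaleR algebra_simps)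

lemma net_E_lift:
  "net_E Adj E D1 G ** lift v = embed_x v ** (E - G ** D1) + embed_y v l ** (G ** D1)"
  by (simp add: matrix_eq net_E_def matrix_vector_expand embed_x_mult embed_y_mult vcat_mult
      kron_mult_lift ev lift_scaleR stack2_add stack2_diff)

lemma net_C_embed_x: "net_C Adj e C2 D2 F ** embed_x v = mode (output_weight Adj e *v v) C2"
  by (simp add: matrix_eq net_C_def matrix_vector_expand embed_x_mult hcat_mult_stack2
      mode_mult_lift kron_mult_lift)

lemma net_C_embed_y:
  "net_C Adj e C2 D2 F ** embed_y v l = mode (output_weight Adj e *v v) (C2 + l *\<^sub>R (D2 ** F))"
  by (simp add: matrix_eq net_C_def matrix_vector_expand embed_y_mult hcat_mult_stack2
      mode_mult_lift kron_mult_lift)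

text \<open>The transpose of the output weight times itself is \<open>R W R^T\<close>, the
  Laplacian, so the squared norm is its quadratic form at \<open>v\<close>. This is the factor
  \<open>l\<close> in the cost of a mode.\<close>

lemma output_weight_norm:
  assumes g: "weighted_graph Adj" and e: "edge_enumeration Adj e" and "v \<bullet> v = 1"
  shows "(output_weight Adj e *v v) \<bullet> (output_weight Adj e *v v) = l"
proof -
  define S where "S = diag_mat (\<lambda>k. sqrt (edge_weight Adj e k))"
  have "0 \<le> edge_weight Adj e k" for k
    using g unfolding edge_weight_def weighted_graph_def by blast
  then have SS: "S ** S = diag_mat (edge_weight Adj e)"
    by (simp add: S_def diag_mat_mult)
  have "transpose S = S"
    by (auto simp: S_def diag_mat_def transpose_def vec_eq_iff)
  then have "transpose (output_weight Adj e) ** output_weight Adj e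
      = incidence e ** (S ** S) ** transpose (incidence e)"
    by (simp add: output_weight_def S_def[symmetric] matrix_transpose_mul matrix_mul_assoc)
  then have "transpose (output_weight Adj e) ** output_weight Adj e = laplacian Adj"
    unfolding SS laplacian_eq_incidence[OF g e] .
  moreover have "(output_weight Adj e *v v) \<bullet> (output_weight Adj e *v v)
      = v \<bullet> ((transpose (output_weight Adj e) ** output_weight Adj e) *v v)"
    by (simp add: matrix_vector_mul_assoc[symmetric] inner_transpose_mult)
  ultimately show ?thesis
    using \<open>v \<bullet> v = 1\<close> by (simp add: ev)
qed

end

text \<open>The generator is commuted to the right of the exponential, next to \<open>X\<close>,
  where the invariance relations for the embeddings apply.\<close>

lemma mat_exp_sandwich_derivative:
  fixes C :: "real^'n^'m" and X :: "real^'k^'n"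
  shows "((\<lambda>t. C ** mat_exp (t *\<^sub>R M) ** X) has_vector_derivative C ** mat_exp (t *\<^sub>R M) ** (M ** X)) (at t)"
proof -
  have "linear (\<lambda>Y :: real^'n^'n. C ** Y ** X)"
    by (intro linearI) (simp_all add: matrix_add_ldistrib matrix_add_rdistrib matrix_scaleR_left matrix_scaleR_right)
  then have "((\<lambda>t. C ** mat_exp (t *\<^sub>R M) ** X) has_vector_derivative C ** (M ** mat_exp (t *\<^sub>R M)) ** X) (at t)"
    by (intro bounded_linear.has_vector_derivative[OF _ mat_exp_has_vector_derivative])
      (simp add: linear_conv_bounded_linear)
  moreover have "M ** mat_exp (t *\<^sub>R M) = mat_exp (t *\<^sub>R M) ** M"
    using mat_exp_intertwine_scaleR[of M M M t] by simp
  ultimately show ?thesis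
    by (simp add: matrix_mul_assoc)
qed

lemma isCont_frob_sq:
  assumes "isCont f t"
  shows "isCont (\<lambda>t. frob_sq (f t)) t"
  using assms unfolding frob_sq_def inner_vec_def by (auto intro!: continuous_intros)

section \<open>Cost of single modes and of the whole network\<close>

context
  fixes Adj :: "real^'N^'N" and e :: "'k::finite \<Rightarrow> 'N \<times> 'N"
    and A Q :: "real^'n^'n" and B :: "real^'m^'n" and E :: "real^'q^'n"
    and C1 :: "real^'n^'r" and D1 :: "real^'q^'r" and C2 :: "real^'n^'p" and D2 :: "real^'m^'p"
    and F :: "real^'n^'m" and G :: "real^'r^'n"
  assumes g: "weighted_graph Adj" and e: "edge_enumeration Adj e"
    and D1E: "D1 ** transpose E = 0" and D1D1: "D1 ** transpose D1 = mat 1"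
    and Q: "pos_def Q"
    and ric: "neg_def (A ** Q + Q ** transpose A - Q ** transpose C1 ** C1 ** Q + E ** transpose E)"
    and G: "G = Q ** transpose C1"
begin

abbreviation "response \<equiv> impulse_response Adj e A B E C1 D1 C2 D2 F G"

text \<open>Reduces a mode to \<open>observer_cost\<close>: the rows of \<open>\<Phi>\<close> and
  \<open>\<Psi>\<close> are those of the impulse response in the coordinates of the cascade, and the
  output weight turns the initial \<open>Q\<close>-form into
  \<open>l * trace (C2 ** Q ** transpose C2)\<close>.\<close>

lemma mode_response_cost:
  fixes v :: "real^'N"
  assumes ev: "laplacian Adj *v v = l *\<^sub>R v" and v: "v \<bullet> v = 1"
    and V: "\<And>t. 0 \<le> t \<Longrightarrow> (V has_real_derivative V' t) (at t)" "\<And>t. 0 \<le> t \<Longrightarrow> 0 \<le> V t"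
    and diss: "\<And>t. 0 \<le> t \<Longrightarrow>
      l * frob_sq ((C2 + l *\<^sub>R (D2 ** F)) ** (mat_exp (t *\<^sub>R (A + l *\<^sub>R (B ** F))) ** G)) \<le> - V' t"
  shows "(\<integral>\<^sup>+ t\<in>{0..}. ennreal (frob_sq (response t ** lift v)) \<partial>lborel)
    \<le> ennreal (l * trace (C2 ** Q ** transpose C2) + V 0)"
proof -
  let ?A = "net_A Adj A B C1 F G" and ?C = "net_C Adj e C2 D2 F" and ?M = "A + l *\<^sub>R (B ** F)"
  define \<Phi> where "\<Phi> t = ?C ** mat_exp (t *\<^sub>R ?A) ** embed_x v" for t
  define \<Psi> where "\<Psi> t = ?C ** mat_exp (t *\<^sub>R ?A) ** embed_y v l" for t
  \<comment> \<open>The range of \<open>embed_y\<close> is invariant, so \<open>\<Psi>\<close> sees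
    the feedback loop alone.\<close>
  have \<Psi>: "\<Psi> t = mode (output_weight Adj e *v v) (C2 + l *\<^sub>R (D2 ** F)) ** mat_exp (t *\<^sub>R ?M)" for t
    unfolding \<Psi>_def matrix_mul_assoc[symmetric] mat_exp_intertwine_scaleR[OF net_A_embed_y[OF ev]]
    by (simp add: matrix_mul_assoc net_C_embed_y[OF ev])
  have 0: "\<Phi> 0 = mode (output_weight Adj e *v v) C2"
    unfolding \<Phi>_def mat_exp_0 by (simp add: net_C_embed_x[OF ev])
  have weight: "(output_weight Adj e *v v) \<bullet> (output_weight Adj e *v v) = l"
    by (rule output_weight_norm[OF ev g e v])
  have "response t ** lift v = \<Phi> t ** (E - G ** D1) + \<Psi> t ** (G ** D1)" for t
    by (simp add: impulse_response_def \<Phi>_def \<Psi>_def matrix_mul_assoc[symmetric] net_E_lift[OF ev]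
        matrix_add_ldistrib)
  moreover have "(\<integral>\<^sup>+ t\<in>{0..}. ennreal (frob_sq (\<Phi> t ** (E - G ** D1) + \<Psi> t ** (G ** D1))) \<partial>lborel)
      \<le> ennreal (trace (\<Phi> 0 ** Q ** transpose (\<Phi> 0)) + V 0)"
  proof (rule observer_cost[OF D1E D1D1 Q ric G _ _ V(1) _ V(2)])
    show "(\<Phi> has_vector_derivative \<Phi> t ** (A - G ** C1) + \<Psi> t ** (G ** C1)) (at t)" for t
      using mat_exp_sandwich_derivative[of ?C ?A "embed_x v" t]
      by (simp add: \<Phi>_def[abs_def] \<Psi>_def net_A_embed_x[OF ev] matrix_add_ldistrib matrix_mul_assoc)
    show "isCont \<Psi> t" for t
      using mat_exp_sandwich_derivative[of ?C ?A "embed_y v l" t]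
      unfolding \<Psi>_def[abs_def] by (rule has_vector_derivative_continuous)
    show "frob_sq (\<Psi> t ** G) \<le> - V' t" if "0 \<le> t" for t
      using diss[OF that] unfolding \<Psi> matrix_mul_assoc[symmetric] frob_sq_mode weight .
  qed
  ultimately show ?thesis
    by (simp add: 0 trace_mode weight)
qed

text \<open>The output weight vanishes for \<open>l = 0\<close>, so the zero storage function
  suffices.\<close>

lemma null_mode_response_cost:
  fixes v :: "real^'N"
  assumes ev: "laplacian Adj *v v = 0" and v: "v \<bullet> v = 1"
  shows "(\<integral>\<^sup>+ t\<in>{0..}. ennreal (frob_sq (response t ** lift v)) \<partial>lborel) = 0"
  using mode_response_cost[of v 0 "\<lambda>t. 0" "\<lambda>t. 0"] ev v by simp

text \<open>Supplies the missing storage function: the columns of \<open>G\<close> evolve by the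
  feedback loop, and \<open>P\<close> dissipates their output energy.\<close>

lemma stable_mode_response_cost:
  fixes v :: "real^'N"
  assumes ev: "laplacian Adj *v v = l *\<^sub>R v" and v: "v \<bullet> v = 1"
    and P: "pos_def P"
    and diss: "\<And>y. 2 * (((A + l *\<^sub>R (B ** F)) *v y) \<bullet> (P *v y))
      + l * (((C2 + l *\<^sub>R (D2 ** F)) *v y) \<bullet> ((C2 + l *\<^sub>R (D2 ** F)) *v y)) \<le> 0"
  shows "(\<integral>\<^sup>+ t\<in>{0..}. ennreal (frob_sq (response t ** lift v)) \<partial>lborel)
    \<le> ennreal (l * trace (C2 ** Q ** transpose C2) + trace (transpose G ** P ** G))"
proof -
  let ?M = "A + l *\<^sub>R (B ** F)"
  \<comment> \<open>Transposed, because \<open>weighted_trace_derivative\<close> works on rows: row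
    \<open>s\<close> is the trajectory started at column \<open>s\<close> of
    \<open>G\<close>.\<close>
  define Z where "Z t = transpose (mat_exp (t *\<^sub>R ?M) ** G)" for t
  define V where "V t = (\<Sum>s\<in>UNIV. Z t $ s \<bullet> (P *v Z t $ s))" for t
  define V' where "V' t = (\<Sum>s\<in>UNIV. 2 * ((Z t ** transpose ?M) $ s \<bullet> (P *v Z t $ s)))" for t
  have symP: "transpose P = P"
    using P by (simp add: pos_def_def)
  have "linear (\<lambda>Y. transpose (Y ** G))"
    by (intro linearI) (simp_all add: transpose_add transpose_scalar matrix_add_rdistrib matrix_scaleR_left)
  then have "(Z has_vector_derivative transpose ((?M ** mat_exp (t *\<^sub>R ?M)) ** G)) (at t)" for t
    unfolding Z_def[abs_def]
    by (intro bounded_linear.has_vector_derivative[OF _ mat_exp_has_vector_derivative])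
      (simp add: linear_conv_bounded_linear)
  then have Z': "(Z has_vector_derivative Z t ** transpose ?M) (at t)" for t
    by (simp add: Z_def matrix_transpose_mul matrix_mul_assoc)
  have "(\<integral>\<^sup>+ t\<in>{0..}. ennreal (frob_sq (response t ** lift v)) \<partial>lborel)
    \<le> ennreal (l * trace (C2 ** Q ** transpose C2) + V 0)"
  proof (rule mode_response_cost[OF ev v])
    show "(V has_real_derivative V' t) (at t)" for t
      using weighted_trace_derivative[OF symP Z'] by (simp add: V_def[abs_def] V'_def)
    show "0 \<le> V t" for t
      by (simp add: V_def sum_nonneg pos_def_nonneg[OF P])
    fix t
    let ?C = "C2 + l *\<^sub>R (D2 ** F)"
    \<comment> \<open>Here the energy passes from rows to columns.\<close>
    have "l * frob_sq (?C ** (mat_exp (t *\<^sub>R ?M) ** G)) = l * frob_sq (Z t ** transpose ?C)"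
      unfolding Z_def matrix_transpose_mul[symmetric] frob_sq_transpose ..
    also have "\<dots> = (\<Sum>s\<in>UNIV. l * ((?C *v Z t $ s) \<bullet> (?C *v Z t $ s)))"
      by (simp add: frob_sq_def matrix_row_mult sum_distrib_left)
    also have "\<dots> \<le> (\<Sum>s\<in>UNIV. - (2 * ((?M *v Z t $ s) \<bullet> (P *v Z t $ s))))"
    proof (rule sum_mono)
      show "l * ((?C *v Z t $ s) \<bullet> (?C *v Z t $ s)) \<le> - (2 * ((?M *v Z t $ s) \<bullet> (P *v Z t $ s)))" for s
        using diss[of "Z t $ s"] by linarith
    qed
    also have "\<dots> = - V' t"
      by (simp add: V'_def matrix_row_mult sum_negf)
    finally show "l * frob_sq (?C ** (mat_exp (t *\<^sub>R ?M) ** G)) \<le> - V' t" .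
  qed
  also have "V 0 = trace (transpose G ** P ** G)"
    unfolding V_def Z_def mat_exp_0 using weighted_trace[of "transpose G" P] by simp
  finally show ?thesis .
qed

text \<open>Parseval splits the cost into modes. The null mode costs nothing, and the other
  \<open>N - 1\<close> modes share one bound since \<open>\<mu> i\<close> is at most
  \<open>lN\<close>.\<close>

lemma H2_cost_bound:
  fixes v :: "'N \<Rightarrow> real^'N"
  assumes v: "\<And>i j. v i \<bullet> v j = (if i = j then 1 else 0)"
    and ev: "\<And>i. laplacian Adj *v v i = \<mu> i *\<^sub>R v i" and i0: "\<mu> i0 = 0"
    and lN: "\<And>i. i \<noteq> i0 \<Longrightarrow> \<mu> i \<le> lN"
    and P: "pos_def P"
    and diss: "\<And>i y. i \<noteq> i0 \<Longrightarrow> 2 * (((A + \<mu> i *\<^sub>R (B ** F)) *v y) \<bullet> (P *v y))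
      + \<mu> i * (((C2 + \<mu> i *\<^sub>R (D2 ** F)) *v y) \<bullet> ((C2 + \<mu> i *\<^sub>R (D2 ** F)) *v y)) \<le> 0"
  shows "H2_cost Adj e A B E C1 D1 C2 D2 F G
    \<le> ennreal ((real CARD('N) - 1) * (trace (transpose G ** P ** G) + lN * trace (C2 ** Q ** transpose C2)))"
proof -
  have vv: "v i \<bullet> v i = 1" for i
    by (simp add: v)
  define f where "f i t = frob_sq (response t ** lift (v i))" for i t
  let ?b = "trace (transpose G ** P ** G) + lN * trace (C2 ** Q ** transpose C2)"
  have tr: "0 \<le> trace (C2 ** Q ** transpose C2)"
    unfolding weighted_trace by (intro sum_nonneg pos_def_nonneg Q)
  have meas [measurable]: "f i \<in> borel_measurable borel" for i
  proof -
    have "isCont (\<lambda>t. response t ** lift (v i)) t" for t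
      using mat_exp_sandwich_derivative[of "net_C Adj e C2 D2 F" "net_A Adj A B C1 F G" "net_E Adj E D1 G ** lift (v i)" t]
      unfolding impulse_response_def matrix_mul_assoc by (rule has_vector_derivative_continuous)
    then have "continuous_on UNIV (f i)"
      unfolding f_def by (intro continuous_at_imp_continuous_on ballI isCont_frob_sq)
    then show ?thesis
      by (simp add: borel_measurable_continuous_onI)
  qed
  have "H2_cost Adj e A B E C1 D1 C2 D2 F G = (\<integral>\<^sup>+ t. (\<Sum>i\<in>UNIV. ennreal (f i t) * indicator {0..} t) \<partial>lborel)"
    unfolding H2_cost_def trace_transpose_mult_self frob_sq_modes[OF v] f_def
    by (simp add: sum_ennreal frob_sq_nonneg sum_distrib_right[symmetric] del: sum_distrib_right)
  also have "\<dots> = (\<Sum>i\<in>UNIV. \<integral>\<^sup>+ t\<in>{0..}. ennreal (f i t) \<partial>lborel)"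
    by (intro nn_integral_sum) measurable
  also have "\<dots> = (\<Sum>i\<in>UNIV - {i0}. \<integral>\<^sup>+ t\<in>{0..}. ennreal (f i t) \<partial>lborel)"
  proof -
    have "laplacian Adj *v v i0 = 0"
      by (simp add: ev i0)
    from null_mode_response_cost[OF this vv]
    have "(\<integral>\<^sup>+ t\<in>{0..}. ennreal (f i0 t) \<partial>lborel) = 0"
      unfolding f_def .
    then show ?thesis
      by (simp only: sum.remove[OF finite UNIV_I, of _ i0] add_0)
  qed
  also have "\<dots> \<le> (\<Sum>i\<in>UNIV - {i0}. ennreal ?b)"
  proof (rule sum_mono)
    fix i assume "i \<in> UNIV - {i0}"
    then have i: "i \<noteq> i0"
      by simp
    have "(\<integral>\<^sup>+ t\<in>{0..}. ennreal (f i t) \<partial>lborel)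
        \<le> ennreal (\<mu> i * trace (C2 ** Q ** transpose C2) + trace (transpose G ** P ** G))"
      unfolding f_def by (rule stable_mode_response_cost[OF ev vv P diss[OF i]])
    also have "\<dots> \<le> ennreal ?b"
      using lN[OF i] tr by (intro ennreal_leI) (simp add: mult_right_mono)
    finally show "(\<integral>\<^sup>+ t\<in>{0..}. ennreal (f i t) \<partial>lborel) \<le> ennreal ?b" .
  qed
  also have "\<dots> = ennreal ((real CARD('N) - 1) * ?b)"
  proof -
    have "real (card (UNIV - {i0} :: 'N set)) = real CARD('N) - 1"
      by (simp add: card_Diff_singleton of_nat_diff Suc_leI)
    then show ?thesis
      by (simp only: sum_constant ennreal_of_nat_eq_real_of_nat ennreal_mult' of_nat_0_le_iff)
  qed
  finally show ?thesis .
qed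

end

section \<open>Exponential decay and synchronization\<close>

text \<open>The product of \<open>V\<close> with \<open>exp (b * t)\<close> does not
  increase.\<close>

lemma exponential_decay:
  fixes V V' :: "real \<Rightarrow> real"
  assumes V: "\<And>t. 0 \<le> t \<Longrightarrow> (V has_real_derivative V' t) (at t within {0..})"
    and decay: "\<And>t. 0 \<le> t \<Longrightarrow> V' t \<le> - b * V t" and b: "0 < b" and V0: "\<And>t. 0 \<le> t \<Longrightarrow> 0 \<le> V t"
  shows "(V \<longlongrightarrow> 0) at_top"
proof -
  define W where "W t = exp (b * t) * V t" for t
  have W: "(W has_real_derivative exp (b * t) * (V' t + b * V t)) (at t within {0..})" if "0 \<le> t" for t
  proof -
    have "((\<lambda>t. exp (b * t)) has_real_derivative exp (b * t) * b) (at t within {0..})"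
      by (auto intro!: derivative_eq_intros)
    from DERIV_mult[OF this V[OF that]] show ?thesis
      by (simp add: W_def[abs_def] algebra_simps)
  qed
  have cont: "continuous_on {0..} W"
    by (rule DERIV_continuous_on) (use W in simp)
  have W_le: "W t \<le> W 0" if "0 \<le> t" for t
  proof (cases "t = 0")
    case False
    \<comment> \<open>The derivative at 0 is only one-sided, so monotonicity comes from the open
      interval together with continuity.\<close>
    show ?thesis
    proof (rule DERIV_nonpos_imp_decreasing_open[of 0 t W])
      show "continuous_on {0..t} W"
        by (rule continuous_on_subset[OF cont]) auto
      fix s assume s: "0 < s" "s < t"
      have "(W has_real_derivative exp (b * s) * (V' s + b * V s)) (at s)"
        using W[of s] s at_within_interior[of s "{0..}"] by simp
      moreover have "exp (b * s) * (V' s + b * V s) \<le> 0"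
        using decay[of s] s by (simp add: mult_le_0_iff)
      ultimately show "\<exists>y. (W has_real_derivative y) (at s) \<and> y \<le> 0"
        by blast
    qed (use False that in auto)
  qed simp
  have V_le: "V t \<le> V 0 * exp (- b * t)" if "0 \<le> t" for t
    using W_le[OF that] by (simp add: W_def exp_minus field_simps)
  have "((\<lambda>t. V 0 * exp (- b * t)) \<longlongrightarrow> V 0 * 0) at_top"
    using b by (intro tendsto_mult tendsto_const filterlim_compose[OF exp_at_bot])
      (simp add: filterlim_uminus_at_bot filterlim_tendsto_pos_mult_at_top[OF tendsto_const b filterlim_ident])
  then have "((\<lambda>t. V 0 * exp (- b * t)) \<longlongrightarrow> 0) at_top"
    by simp
  then show ?thesis
    using V0 V_le by (intro tendsto_sandwich[of "\<lambda>_. 0" V at_top "\<lambda>t. V 0 * exp (- b * t)" 0])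
      (auto simp: eventually_at_top_linorder)
qed

lemma symmetric_form_derivative:
  fixes f :: "real \<Rightarrow> real^'n"
  assumes S: "transpose S = S" and f: "(f has_vector_derivative f') (at t within T)"
  shows "((\<lambda>t. f t \<bullet> (S *v f t)) has_real_derivative 2 * (f' \<bullet> (S *v f t))) (at t within T)"
proof -
  have "((\<lambda>t. f t \<bullet> (S *v f t)) has_vector_derivative f t \<bullet> (S *v f') + f' \<bullet> (S *v f t)) (at t within T)"
    by (intro bounded_bilinear.has_vector_derivative[OF bounded_bilinear_inner]
        bounded_linear.has_vector_derivative[OF matrix_vector_mul_bounded_linear] f)
  moreover have "f t \<bullet> (S *v f') = f' \<bullet> (S *v f t)"
    by (subst inner_symmetric_mult[OF S]) (rule inner_commute)
  ultimately show ?thesis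
    by (simp add: has_real_derivative_iff_has_vector_derivative)
qed

lemma quadratic_form_upper_bound:
  fixes S :: "real^'n^'n"
  shows "\<exists>K>0. \<forall>x. x \<bullet> (S *v x) \<le> K * (x \<bullet> x)"
proof -
  obtain K where K: "K > 0" "\<And>x. norm (S *v x) \<le> K * norm x"
    using mult_norm_le by metis
  have "x \<bullet> (S *v x) \<le> K * (x \<bullet> x)" for x
  proof -
    have "x \<bullet> (S *v x) \<le> norm x * norm (S *v x)"
      by (rule norm_cauchy_schwarz)
    also have "\<dots> \<le> norm x * (K * norm x)"
      by (intro mult_left_mono K) auto
    finally show ?thesis
      by (simp add: power2_norm_eq_inner[symmetric] power2_eq_square algebra_simps)
  qed
  then show ?thesis
    using K(1) by blast
qed

text \<open>A sum of the two Lyapunov forms, with a large weight \<open>k\<close> on the driving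
  part \<open>h\<close>, dominates the coupling term.\<close>

lemma cascade_decay:
  fixes h w :: "real \<Rightarrow> real^'n"
  assumes h: "\<And>t. 0 \<le> t \<Longrightarrow> (h has_vector_derivative H *v h t) (at t within {0..})"
    and w: "\<And>t. 0 \<le> t \<Longrightarrow> (w has_vector_derivative M *v w t + K *v h t) (at t within {0..})"
    and S: "pos_def S" "0 < a" "\<And>y. 2 * ((H *v y) \<bullet> (S *v y)) \<le> - a * (y \<bullet> y)"
    and P: "pos_def P" "0 < b" "\<And>y. 2 * ((M *v y) \<bullet> (P *v y)) \<le> - b * (y \<bullet> y)"
  shows "(h \<longlongrightarrow> 0) at_top" and "(w \<longlongrightarrow> 0) at_top"
proof -
  obtain q where q: "q > 0" "\<And>x. ((P ** K) *v x) \<bullet> ((P ** K) *v x) \<le> q * (x \<bullet> x)"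
    using square_norm_le[of "P ** K"] by metis
  have symS: "transpose S = S" and symP: "transpose P = P"
    using S P by (auto simp: pos_def_def)
  have cross: "2 * ((K *v x) \<bullet> (P *v y)) \<le> b / 2 * (y \<bullet> y) + 2 * q / b * (x \<bullet> x)" for x y
  proof -
    define v where "v = (P ** K) *v x"
    have Kv: "(K *v x) \<bullet> (P *v y) = v \<bullet> y"
      by (simp add: v_def inner_symmetric_mult[OF symP] matrix_vector_mul_assoc)
    have "(b *\<^sub>R y - 2 *\<^sub>R v) \<bullet> (b *\<^sub>R y - 2 *\<^sub>R v) = b\<^sup>2 * (y \<bullet> y) - 4 * b * (v \<bullet> y) + 4 * (v \<bullet> v)"
      by (simp add: inner_diff_left inner_diff_right inner_commute[of y v] power2_eq_square
          algebra_simps)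
    moreover have "0 \<le> (b *\<^sub>R y - 2 *\<^sub>R v) \<bullet> (b *\<^sub>R y - 2 *\<^sub>R v)"
      by (rule inner_ge_zero)
    ultimately have "4 * b * ((K *v x) \<bullet> (P *v y)) \<le> b\<^sup>2 * (y \<bullet> y) + 4 * (v \<bullet> v)"
      unfolding Kv by linarith
    also have "\<dots> \<le> b\<^sup>2 * (y \<bullet> y) + 4 * (q * (x \<bullet> x))"
      using q(2)[of x] unfolding v_def by linarith
    finally show ?thesis
      using P(2) by (simp add: field_simps power2_eq_square)
  qed
  \<comment> \<open>In \<open>k * a\<close>, the summand \<open>2 * q / b\<close> absorbs the
    coupling and \<open>b / 2\<close> leaves the same decay rate for \<open>h\<close> as for
    \<open>w\<close>.\<close>
  define k where "k = (2 * q / b + b / 2) / a"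
  have k: "k > 0" "k * a = 2 * q / b + b / 2"
    using q(1) P(2) S(2) by (auto simp: k_def add_pos_pos)
  define V where "V t = k * (h t \<bullet> (S *v h t)) + w t \<bullet> (P *v w t)" for t
  define V' where "V' t = k * (2 * ((H *v h t) \<bullet> (S *v h t))) + 2 * ((M *v w t + K *v h t) \<bullet> (P *v w t))" for t
  define n where "n t = h t \<bullet> h t + w t \<bullet> w t" for t
  have V'_le: "V' t \<le> - (b / 2) * n t" for t
  proof -
    have "k * (2 * ((H *v h t) \<bullet> (S *v h t))) \<le> k * (- a * (h t \<bullet> h t))"
      using S(3) k(1) by (intro mult_left_mono) auto
    also have "\<dots> = - (2 * q / b + b / 2) * (h t \<bullet> h t)"
      by (simp add: k(2)[symmetric])
    finally show ?thesis
      using P(3)[of "w t"] cross[of "h t" "w t"] by (simp add: V'_def n_def inner_add_left algebra_simps)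
  qed
  obtain s where s: "s > 0" "\<And>x. x \<bullet> (S *v x) \<le> s * (x \<bullet> x)"
    using quadratic_form_upper_bound by metis
  obtain p where p: "p > 0" "\<And>x. x \<bullet> (P *v x) \<le> p * (x \<bullet> x)"
    using quadratic_form_upper_bound by metis
  obtain s' where s': "s' > 0" "\<And>x. s' * (x \<bullet> x) \<le> x \<bullet> (S *v x)"
    using pos_def_lower_bound[of S] S(1) by (auto simp: pos_def_def)
  obtain p' where p': "p' > 0" "\<And>x. p' * (x \<bullet> x) \<le> x \<bullet> (P *v x)"
    using pos_def_lower_bound[of P] P(1) by (auto simp: pos_def_def)
  define u where "u = k * s + p"
  define d where "d = min (k * s') p'"
  have u: "u > 0" and d: "d > 0"
    using k s p s' p' by (auto simp: u_def d_def add_pos_pos)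
  have V_le: "V t \<le> u * n t" for t
  proof -
    have "V t \<le> k * (s * (h t \<bullet> h t)) + p * (w t \<bullet> w t)"
      unfolding V_def using k by (intro add_mono mult_left_mono s p) auto
    also have "\<dots> \<le> k * (s * (h t \<bullet> h t)) + p * (w t \<bullet> w t) + (k * s * (w t \<bullet> w t) + p * (h t \<bullet> h t))"
      using k s p by simp
    finally show ?thesis
      by (simp add: u_def n_def algebra_simps)
  qed
  have le_V: "d * n t \<le> V t" for t
  proof -
    have "d * n t = d * (h t \<bullet> h t) + d * (w t \<bullet> w t)"
      by (simp add: n_def algebra_simps)
    also have "\<dots> \<le> (k * s') * (h t \<bullet> h t) + p' * (w t \<bullet> w t)"
      by (intro add_mono mult_right_mono) (auto simp: d_def)
    also have "\<dots> \<le> V t"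
      unfolding V_def mult.assoc using k by (intro add_mono mult_left_mono s' p') auto
    finally show ?thesis .
  qed
  have n0: "0 \<le> n t" for t
    by (simp add: n_def)
  have "(V \<longlongrightarrow> 0) at_top"
  proof (rule exponential_decay[where V' = V' and b = "b / 2 / u"])
    show "(V has_real_derivative V' t) (at t within {0..})" if "0 \<le> t" for t
      unfolding V_def[abs_def] V'_def
      by (intro DERIV_add DERIV_cmult symmetric_form_derivative symS symP h w that)
    show "V' t \<le> - (b / 2 / u) * V t" for t
    proof -
      have "(b / 2 / u) * V t \<le> (b / 2 / u) * (u * n t)"
        using V_le P(2) u by (intro mult_left_mono) auto
      then show ?thesis
        using V'_le[of t] u by simp
    qed
    show "0 \<le> V t" for t
      using le_V[of t] n0[of t] d by (meson less_imp_le mult_nonneg_nonneg order_trans)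
  qed (use P(2) u in auto)
  then have "((\<lambda>t. V t / d) \<longlongrightarrow> 0 / d) at_top"
    using d by (intro tendsto_divide tendsto_const) auto
  then have "((\<lambda>t. V t / d) \<longlongrightarrow> 0) at_top"
    by simp
  then have sqrt: "((\<lambda>t. sqrt (V t / d)) \<longlongrightarrow> 0) at_top"
    using tendsto_real_sqrt by fastforce
  have nV: "n t \<le> V t / d" for t
    using le_V[of t] d by (simp add: field_simps)
  have "norm (h t) \<le> sqrt (V t / d)" "norm (w t) \<le> sqrt (V t / d)" for t
    using nV[of t] unfolding n_def norm_eq_sqrt_inner
    by (auto intro!: real_sqrt_le_mono) (smt (verit) inner_ge_zero)+
  then show "(h \<longlongrightarrow> 0) at_top" "(w \<longlongrightarrow> 0) at_top"
    by (auto intro!: Lim_null_comparison[OF _ sqrt] always_eventually)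
qed

text \<open>The inverse of \<open>Q\<close> serves as Lyapunov matrix. Substituting
  \<open>y = Q *v z\<close> turns its derivative into the form of the inequality for
  \<open>Q\<close> at \<open>z\<close>, minus the squares of \<open>C1 *v (Q *v z)\<close> and
  \<open>transpose E *v z\<close>.\<close>

lemma observer_lyapunov:
  fixes A :: "real^'n^'n" and E :: "real^'q^'n" and C1 :: "real^'n^'r"
  assumes Q: "pos_def Q"
    and ric: "neg_def (A ** Q + Q ** transpose A - Q ** transpose C1 ** C1 ** Q + E ** transpose E)"
  shows "\<exists>S a. 0 < a \<and> pos_def S \<and> (\<forall>y. 2 * (((A - Q ** transpose C1 ** C1) *v y) \<bullet> (S *v y)) \<le> - a * (y \<bullet> y))"
proof -
  have symQ: "transpose Q = Q" and posQ: "\<And>x. x \<noteq> 0 \<Longrightarrow> 0 < x \<bullet> (Q *v x)"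
    using Q by (auto simp: pos_def_def)
  have "x = 0" if "Q *v x = 0" for x
    using posQ[of x] that by fastforce
  then obtain S where SQ: "S ** Q = mat 1"
    using matrix_left_invertible_ker[of Q] by blast
  then have QS: "Q ** S = mat 1"
    by (simp add: matrix_left_right_inverse)
  have "transpose S ** Q = mat 1"
    by (metis QS matrix_transpose_mul symQ transpose_mat)
  then have symS: "transpose S = S"
    by (metis QS matrix_mul_assoc matrix_mul_lid matrix_mul_rid)
  have "0 < y \<bullet> (S *v y)" if "y \<noteq> 0" for y
  proof -
    have y: "y = Q *v (S *v y)"
      by (simp add: matrix_vector_mul_assoc QS)
    then have "S *v y \<noteq> 0"
      using that by (metis matrix_vector_mult_0_right)
    then have "0 < (S *v y) \<bullet> (Q *v (S *v y))"
      by (rule posQ)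
    then show ?thesis
      by (simp add: y[symmetric] inner_commute)
  qed
  then have "pos_def S"
    using symS by (simp add: pos_def_def)
  obtain a where a: "a > 0" "\<And>z. z \<bullet> ((A ** Q + Q ** transpose A - Q ** transpose C1 ** C1 ** Q + E ** transpose E) *v z) \<le> - a * (z \<bullet> z)"
    using neg_def_upper_bound[OF ric] by blast
  obtain K where K: "K > 0" "\<And>z. (Q *v z) \<bullet> (Q *v z) \<le> K * (z \<bullet> z)"
    using square_norm_le by metis
  have "2 * (((A - Q ** transpose C1 ** C1) *v y) \<bullet> (S *v y)) \<le> - (a / K) * (y \<bullet> y)" for y
  proof -
    define z where "z = S *v y"
    have y: "y = Q *v z"
      by (simp add: z_def matrix_vector_mul_assoc QS)
    let ?c = "C1 *v (Q *v z)" and ?e = "transpose E *v z"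
    have "z \<bullet> (Q *v (transpose A *v z)) = (A *v (Q *v z)) \<bullet> z"
      by (simp add: inner_symmetric_mult[OF symQ] inner_transpose_mult)
    moreover have "z \<bullet> (Q *v (transpose C1 *v ?c)) = ?c \<bullet> ?c"
      by (simp add: inner_symmetric_mult[OF symQ] inner_transpose_mult)
    moreover have "z \<bullet> (E *v ?e) = ?e \<bullet> ?e"
      using inner_transpose_mult[of z "transpose E" ?e] by simp
    moreover have "z \<bullet> (A *v (Q *v z)) = (A *v (Q *v z)) \<bullet> z"
      by (rule inner_commute)
    ultimately have "2 * ((A *v (Q *v z)) \<bullet> z) - ?c \<bullet> ?c + ?e \<bullet> ?e \<le> - a * (z \<bullet> z)"
      using a(2)[of z] by (simp add: matrix_vector_expand inner_add_right inner_diff_right)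
    moreover have "((A - Q ** transpose C1 ** C1) *v y) \<bullet> z = (A *v (Q *v z)) \<bullet> z - ?c \<bullet> ?c"
    proof -
      have "(Q *v (transpose C1 *v ?c)) \<bullet> z = z \<bullet> (Q *v (transpose C1 *v ?c))"
        by (rule inner_commute)
      then show ?thesis
        using \<open>z \<bullet> (Q *v (transpose C1 *v ?c)) = ?c \<bullet> ?c\<close>
        unfolding z_def[symmetric] by (simp add: y matrix_vector_expand inner_diff_left)
    qed
    moreover have "0 \<le> ?c \<bullet> ?c" "0 \<le> ?e \<bullet> ?e"
      by (rule inner_ge_zero)+
    ultimately have "2 * (((A - Q ** transpose C1 ** C1) *v y) \<bullet> (S *v y)) \<le> - a * (z \<bullet> z)"
      unfolding z_def[symmetric] by linarith
    \<comment> \<open>Converts the decay in \<open>z\<close> back to a decay in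
      \<open>y\<close>.\<close>
    also have "(y \<bullet> y) / K \<le> z \<bullet> z"
      using K(2)[of z] K(1) by (simp add: y field_simps)
    then have "- a * (z \<bullet> z) \<le> - (a / K) * (y \<bullet> y)"
      using a(1) by (simp add: mult_left_mono flip: times_divide_eq_right)
    finally show ?thesis .
  qed
  then show ?thesis
    using \<open>pos_def S\<close> a(1) K(1) by (intro exI[of _ S] exI[of _ "a / K"]) auto
qed

text \<open>Symmetry lets the Laplacian act on the weights \<open>v\<close> instead of the signals
  of the agents.\<close>

lemma eigenvector_weighted_laplacian_sum:
  fixes Adj :: "real^'N^'N" and s :: "'N \<Rightarrow> real^'n"
  assumes g: "weighted_graph Adj" and ev: "laplacian Adj *v v = l *\<^sub>R v"
  shows "(\<Sum>j\<in>UNIV. v $ j *\<^sub>R (\<Sum>k\<in>UNIV. Adj $ j $ k *\<^sub>R (s j - s k))) = l *\<^sub>R (\<Sum>j\<in>UNIV. v $ j *\<^sub>R s j)"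
proof -
  have sym: "laplacian Adj $ j $ k = laplacian Adj $ k $ j" for j k
    using transpose_laplacian[OF g] by (simp add: transpose_def vec_eq_iff)
  have "(\<Sum>j\<in>UNIV. v $ j *\<^sub>R (\<Sum>k\<in>UNIV. laplacian Adj $ j $ k *\<^sub>R s k))
      = (\<Sum>k\<in>UNIV. \<Sum>j\<in>UNIV. (v $ j * laplacian Adj $ j $ k) *\<^sub>R s k)"
    by (simp add: scaleR_sum_right) (rule sum.swap)
  also have "\<dots> = (\<Sum>k\<in>UNIV. (laplacian Adj *v v) $ k *\<^sub>R s k)"
    by (intro sum.cong refl)
      (simp add: matrix_vector_mult_def scaleR_sum_left sym[of _ k for k] mult.commute)
  finally show ?thesis
    by (simp add: laplacian_sum ev scaleR_sum_right)
qed

lemma matrix_mult_weighted_sum: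
  fixes M :: "real^'c^'d"
  shows "M *v (\<Sum>j\<in>J. r j *\<^sub>R f j) = (\<Sum>j\<in>J. r j *\<^sub>R (M *v f j))"
  by (simp add: linear_sum[OF matrix_vector_mul_linear] matrix_vector_mult_scaleR)

text \<open>Projecting an arbitrary closed-loop solution onto \<open>v\<close> turns the graph sums
  into multiplication by \<open>l\<close>. Then \<open>X - W / l\<close> and \<open>W / l\<close>
  form a cascade, without any recourse to the matrix exponential.\<close>

lemma closed_loop_mode_decay:
  fixes v :: "real^'N" and x w :: "'N \<Rightarrow> real \<Rightarrow> real^'n"
  assumes g: "weighted_graph Adj" and ev: "laplacian Adj *v v = l *\<^sub>R v" and l: "l \<noteq> 0"
    and S: "pos_def S" "0 < a" "\<And>y. 2 * (((A - G ** C1) *v y) \<bullet> (S *v y)) \<le> - a * (y \<bullet> y)"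
    and P: "pos_def P" "0 < b" "\<And>y. 2 * (((A + l *\<^sub>R (B ** F)) *v y) \<bullet> (P *v y)) \<le> - b * (y \<bullet> y)"
    and cl: "closed_loop Adj A B E C1 D1 F G (\<lambda>i t. 0) x w"
  shows "((\<lambda>t. \<Sum>j\<in>UNIV. v $ j *\<^sub>R x j t) \<longlongrightarrow> 0) at_top"
    and "((\<lambda>t. \<Sum>j\<in>UNIV. v $ j *\<^sub>R w j t) \<longlongrightarrow> 0) at_top"
proof -
  define X where "X t = (\<Sum>j\<in>UNIV. v $ j *\<^sub>R x j t)" for t
  define W where "W t = (\<Sum>j\<in>UNIV. v $ j *\<^sub>R w j t)" for t
  have X: "(X has_vector_derivative A *v X t + B *v (F *v W t)) (at t within {0..})" if "0 \<le> t" for t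
  proof -
    have "(X has_vector_derivative (\<Sum>j\<in>UNIV. v $ j *\<^sub>R (A *v x j t + B *v (F *v w j t)))) (at t within {0..})"
      unfolding X_def[abs_def] using cl that
      by (intro has_vector_derivative_sum bounded_linear.has_vector_derivative[OF bounded_linear_scaleR_right])
        (simp add: closed_loop_def Let_def)
    then show ?thesis
      by (simp add: X_def W_def matrix_mult_weighted_sum sum.distrib scaleR_add_right)
  qed
  have W: "(W has_vector_derivative A *v W t + l *\<^sub>R (B *v (F *v W t)) + G *v (l *\<^sub>R (C1 *v X t) - C1 *v W t))
      (at t within {0..})" if "0 \<le> t" for t
  proof -
    have "(W has_vector_derivative (\<Sum>j\<in>UNIV. v $ j *\<^sub>R (A *v w j t
        + B *v (\<Sum>k\<in>UNIV. Adj $ j $ k *\<^sub>R (F *v w j t - F *v w k t))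
        + G *v ((\<Sum>k\<in>UNIV. Adj $ j $ k *\<^sub>R (C1 *v x j t - C1 *v x k t)) - C1 *v w j t)))) (at t within {0..})"
      unfolding W_def[abs_def] using cl that
      by (intro has_vector_derivative_sum bounded_linear.has_vector_derivative[OF bounded_linear_scaleR_right])
        (simp add: closed_loop_def Let_def)
    moreover have "(\<Sum>j\<in>UNIV. v $ j *\<^sub>R (A *v w j t
        + B *v (\<Sum>k\<in>UNIV. Adj $ j $ k *\<^sub>R (F *v w j t - F *v w k t))
        + G *v ((\<Sum>k\<in>UNIV. Adj $ j $ k *\<^sub>R (C1 *v x j t - C1 *v x k t)) - C1 *v w j t)))
      = A *v W t + B *v (l *\<^sub>R (F *v W t)) + G *v (l *\<^sub>R (C1 *v X t) - C1 *v W t)"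
      \<comment> \<open>Linearity and the eigenvector identity are run backwards to gather the
        right-hand side into a single sum.\<close>
      unfolding W_def X_def matrix_mult_weighted_sum eigenvector_weighted_laplacian_sum[OF g ev, symmetric]
        sum_subtractf[symmetric] scaleR_diff_right[symmetric] scaleR_add_right[symmetric] sum.distrib[symmetric]
      by (simp add: matrix_mult_weighted_sum)
    ultimately show ?thesis
      by (simp add: matrix_vector_mult_scaleR)
  qed
  define h where "h t = X t - (1 / l) *\<^sub>R W t" for t
  define u where "u t = (1 / l) *\<^sub>R W t" for t
  have u: "(u has_vector_derivative (A + l *\<^sub>R (B ** F)) *v u t + (G ** C1) *v h t) (at t within {0..})" if "0 \<le> t" for t
  proof -
    have "(u has_vector_derivative (1 / l) *\<^sub>R (A *v W t + l *\<^sub>R (B *v (F *v W t)) + G *v (l *\<^sub>R (C1 *v X t) - C1 *v W t)))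
        (at t within {0..})"
      unfolding u_def[abs_def]
      by (intro bounded_linear.has_vector_derivative[OF bounded_linear_scaleR_right] W that)
    also have "(1 / l) *\<^sub>R (A *v W t + l *\<^sub>R (B *v (F *v W t)) + G *v (l *\<^sub>R (C1 *v X t) - C1 *v W t))
        = (A + l *\<^sub>R (B ** F)) *v u t + (G ** C1) *v h t"
      using l by (simp add: u_def h_def matrix_vector_expand scaleR_add_right scaleR_diff_right)
    finally show ?thesis .
  qed
  have h: "(h has_vector_derivative (A - G ** C1) *v h t) (at t within {0..})" if "0 \<le> t" for t
  proof -
    have "((\<lambda>t. X t - u t) has_vector_derivative A *v X t + B *v (F *v W t)
        - ((A + l *\<^sub>R (B ** F)) *v u t + (G ** C1) *v h t)) (at t within {0..})"
      by (intro has_vector_derivative_diff X u that)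
    also have "(\<lambda>t. X t - u t) = h"
      by (simp add: h_def[abs_def] u_def)
    also have "A *v X t + B *v (F *v W t) - ((A + l *\<^sub>R (B ** F)) *v u t + (G ** C1) *v h t)
        = (A - G ** C1) *v h t"
      using l by (simp add: u_def h_def matrix_vector_expand scaleR_add_right scaleR_diff_right)
    finally show ?thesis .
  qed
  have lim: "(h \<longlongrightarrow> 0) at_top" "(u \<longlongrightarrow> 0) at_top"
    by (rule cascade_decay[OF h u S P]; assumption)+
  have "((\<lambda>t. h t + u t) \<longlongrightarrow> 0 + 0) at_top" "((\<lambda>t. l *\<^sub>R u t) \<longlongrightarrow> l *\<^sub>R 0) at_top"
    by (intro tendsto_add tendsto_scaleR tendsto_const lim)+
  moreover have "(\<lambda>t. h t + u t) = X" "(\<lambda>t. l *\<^sub>R u t) = W"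
    using l by (auto simp: h_def u_def)
  ultimately show "((\<lambda>t. \<Sum>j\<in>UNIV. v $ j *\<^sub>R x j t) \<longlongrightarrow> 0) at_top"
    "((\<lambda>t. \<Sum>j\<in>UNIV. v $ j *\<^sub>R w j t) \<longlongrightarrow> 0) at_top"
    by (simp_all add: X_def[abs_def] W_def[abs_def])
qed

text \<open>In the expansion along the eigenbasis, the \<open>i0\<close> component is the same for
  all agents and cancels in a difference; the others vanish in the limit.\<close>

lemma disagreement_tendsto_zero:
  fixes v :: "'N \<Rightarrow> real^'N" and f :: "'N \<Rightarrow> real \<Rightarrow> real^'n"
  assumes v: "\<And>i j. v i \<bullet> v j = (if i = j then 1 else 0)"
    and const: "\<And>j k. v i0 $ j = v i0 $ k"
    and lim: "\<And>i. i \<noteq> i0 \<Longrightarrow> ((\<lambda>t. \<Sum>j\<in>UNIV. v i $ j *\<^sub>R f j t) \<longlongrightarrow> 0) F"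
  shows "((\<lambda>t. f j t - f k t) \<longlongrightarrow> 0) F"
proof -
  have f: "f j t = (\<Sum>i\<in>UNIV. v i $ j *\<^sub>R (\<Sum>l\<in>UNIV. v i $ l *\<^sub>R f l t))" for j t
  proof -
    have "(\<Sum>i\<in>UNIV. v i $ j *\<^sub>R (\<Sum>l\<in>UNIV. v i $ l *\<^sub>R f l t))
        = (\<Sum>l\<in>UNIV. (\<Sum>i\<in>UNIV. v i $ j * v i $ l) *\<^sub>R f l t)"
      unfolding scaleR_sum_right scaleR_sum_left scaleR_scaleR by (rule sum.swap)
    also have "\<dots> = (\<Sum>l\<in>UNIV. if j = l then f l t else 0)"
      unfolding orthonormal_expansion(1)[OF v] by (intro sum.cong) auto
    finally show ?thesis by simp
  qed
  have "((\<lambda>t. \<Sum>i\<in>UNIV. (v i $ j - v i $ k) *\<^sub>R (\<Sum>l\<in>UNIV. v i $ l *\<^sub>R f l t)) \<longlongrightarrow> (\<Sum>i\<in>(UNIV :: 'N set). 0)) F"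
  proof (rule tendsto_sum)
    show "((\<lambda>t. (v i $ j - v i $ k) *\<^sub>R (\<Sum>l\<in>UNIV. v i $ l *\<^sub>R f l t)) \<longlongrightarrow> 0) F" for i
    proof (cases "i = i0")
      case True
      then have "v i $ j - v i $ k = 0"
        using const[of j k] by simp
      then show ?thesis
        by simp
    next
      case False
      show ?thesis
        using tendsto_scaleR[OF tendsto_const[of "v i $ j - v i $ k"] lim[OF False]]
        by (simp only: scaleR_zero_right)
    qed
  qed
  moreover have "(\<lambda>t. \<Sum>i\<in>UNIV. (v i $ j - v i $ k) *\<^sub>R (\<Sum>l\<in>UNIV. v i $ l *\<^sub>R f l t))
      = (\<lambda>t. f j t - f k t)"
    by (simp only: scaleR_diff_left sum_subtractf f[symmetric])
  ultimately show ?thesis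
    by (simp only: sum.neutral_const)
qed

text \<open>One coefficient \<open>\<kappa>\<close> that dominates the cubic at all nonzero modes
  covers both cases, so a single \<open>P\<close> dissipates every mode.\<close>

lemma protocol_synchronizes_and_suboptimal:
  fixes A :: "real^'n^'n" and B :: "real^'m^'n" and E :: "real^'q^'n"
    and C1 :: "real^'n^'r" and D1 :: "real^'q^'r"
    and C2 :: "real^'n^'p" and D2 :: "real^'m^'p"
    and Adj :: "real^'N^'N" and e :: "'k::finite \<Rightarrow> 'N \<times> 'N" and v :: "'N \<Rightarrow> real^'N"
  assumes card: "CARD('N) \<ge> 2" and \<gamma>: "0 < \<gamma>"
    and g: "weighted_graph Adj" and e: "edge_enumeration Adj e"
    and v: "\<And>i j. v i \<bullet> v j = (if i = j then 1 else 0)"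
    and ev: "\<And>i. laplacian Adj *v v i = \<mu> i *\<^sub>R v i" and i0: "\<mu> i0 = 0"
    and const: "\<And>j k. v i0 $ j = v i0 $ k"
    and \<mu>: "\<And>i. i \<noteq> i0 \<Longrightarrow> 0 < \<mu> i" "\<And>i. i \<noteq> i0 \<Longrightarrow> \<mu> i \<le> lN"
    and coeff: "\<And>i. i \<noteq> i0 \<Longrightarrow> c\<^sup>2 * \<mu> i ^ 3 - 2 * c * \<mu> i \<le> \<kappa>"
    and D1E: "D1 ** transpose E = 0" and D2C2: "transpose D2 ** C2 = 0"
    and D1D1: "D1 ** transpose D1 = mat 1" and D2D2: "transpose D2 ** D2 = mat 1"
    and Q: "pos_def Q"
    and ricQ: "neg_def (A ** Q + Q ** transpose A - Q ** transpose C1 ** C1 ** Q + E ** transpose E)"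
    and P: "pos_def P"
    and ricP: "neg_def (transpose A ** P + P ** A + \<kappa> *\<^sub>R (P ** B ** transpose B ** P)
      + lN *\<^sub>R (transpose C2 ** C2))"
    and small: "trace (C1 ** Q ** P ** Q ** transpose C1) + lN * trace (C2 ** Q ** transpose C2)
      < \<gamma> / (real CARD('N) - 1)"
  defines "F \<equiv> (- c) *\<^sub>R (transpose B ** P)" and "G \<equiv> Q ** transpose C1"
  shows "synchronizes Adj A B E C1 D1 F G" and "H2_cost Adj e A B E C1 D1 C2 D2 F G < ennreal \<gamma>"
proof -
  have symP: "transpose P = P" and symQ: "transpose Q = Q"
    using P Q by (auto simp: pos_def_def)
  obtain b where b: "b > 0" "\<And>y. y \<bullet> ((transpose A ** P + P ** A + \<kappa> *\<^sub>R (P ** B ** transpose B ** P)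
      + lN *\<^sub>R (transpose C2 ** C2)) *v y) \<le> - b * (y \<bullet> y)"
    using neg_def_upper_bound[OF ricP] by blast
  have diss: "2 * (((A + \<mu> i *\<^sub>R (B ** F)) *v y) \<bullet> (P *v y))
      + \<mu> i * (((C2 + \<mu> i *\<^sub>R (D2 ** F)) *v y) \<bullet> ((C2 + \<mu> i *\<^sub>R (D2 ** F)) *v y)) \<le> - b * (y \<bullet> y)"
    if i: "i \<noteq> i0" for i y
    using feedback_dissipation[OF D2C2 D2D2 symP F_def[THEN meta_eq_to_obj_eq] less_imp_le[OF \<mu>(1)[OF i]] \<mu>(2)[OF i] coeff[OF i], of A y]
      b(2)[of y] by linarith
  show "synchronizes Adj A B E C1 D1 F G"
    unfolding synchronizes_def
  proof (intro allI impI)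
    fix x w j k
    assume cl: "closed_loop Adj A B E C1 D1 F G (\<lambda>i t. 0) x w"
    obtain S a where S: "pos_def S" "0 < a" "\<And>y. 2 * (((A - G ** C1) *v y) \<bullet> (S *v y)) \<le> - a * (y \<bullet> y)"
      using observer_lyapunov[OF Q ricQ] unfolding G_def by blast
    have stable: "2 * (((A + \<mu> i *\<^sub>R (B ** F)) *v y) \<bullet> (P *v y)) \<le> - b * (y \<bullet> y)" if i: "i \<noteq> i0" for i y
    proof -
      have "0 \<le> \<mu> i * (((C2 + \<mu> i *\<^sub>R (D2 ** F)) *v y) \<bullet> ((C2 + \<mu> i *\<^sub>R (D2 ** F)) *v y))"
        using \<mu>(1)[OF i] by (intro mult_nonneg_nonneg inner_ge_zero less_imp_le)
      then show ?thesis
        using diss[OF i, of y] by linarith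
    qed
    have ne: "\<mu> i \<noteq> 0" if "i \<noteq> i0" for i
      using \<mu>(1)[OF that] by simp
    show "((\<lambda>t. x j t - x k t) \<longlongrightarrow> 0) at_top \<and> ((\<lambda>t. w j t - w k t) \<longlongrightarrow> 0) at_top"
      by (intro conjI disagreement_tendsto_zero[OF v const]
          closed_loop_mode_decay[OF g ev ne S P b(1) stable cl])
  qed
  have "H2_cost Adj e A B E C1 D1 C2 D2 F G
      \<le> ennreal ((real CARD('N) - 1) * (trace (transpose G ** P ** G) + lN * trace (C2 ** Q ** transpose C2)))"
  proof (rule H2_cost_bound[OF g e D1E D1D1 Q ricQ _ v ev i0 \<mu>(2) P])
    show "2 * (((A + \<mu> i *\<^sub>R (B ** F)) *v y) \<bullet> (P *v y))
      + \<mu> i * (((C2 + \<mu> i *\<^sub>R (D2 ** F)) *v y) \<bullet> ((C2 + \<mu> i *\<^sub>R (D2 ** F)) *v y)) \<le> 0" if "i \<noteq> i0" for i y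
      using diss[OF that, of y] mult_nonneg_nonneg[OF less_imp_le[OF b(1)] inner_ge_zero[of y]] by linarith
  qed (simp_all add: G_def)
  also have "\<dots> < ennreal \<gamma>"
  proof (rule ennreal_lessI)
    have "transpose G ** P ** G = C1 ** Q ** P ** Q ** transpose C1"
      by (simp add: G_def matrix_transpose_mul symQ matrix_mul_assoc)
    then show "(real CARD('N) - 1) * (trace (transpose G ** P ** G) + lN * trace (C2 ** Q ** transpose C2)) < \<gamma>"
      using small card by (simp add: pos_less_divide_eq mult.commute)
  qed (rule \<gamma>)
  finally show "H2_cost Adj e A B E C1 D1 C2 D2 F G < ennreal \<gamma>" .
qed

theorem theorem7:
  fixes A :: "real^'n^'n" and B :: "real^'m^'n" and E :: "real^'q^'n"
    and C1 :: "real^'n^'r" and D1 :: "real^'q^'r"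
    and C2 :: "real^'n^'p" and D2 :: "real^'m^'p"
    and Adj :: "real^'N^'N" and e :: "'k::finite \<Rightarrow> 'N \<times> 'N"
    and lam :: "nat \<Rightarrow> real" and l2 lN \<gamma> c :: real and Q :: "real^'n^'n"
  assumes "CARD('N) \<ge> 2"
    and "stabilizable A B" and "detectable C1 A"
    and "weighted_graph Adj" and "connected_graph Adj" and "edge_enumeration Adj e"
    and "ordered_eigenvalues (laplacian Adj) lam"
    and "l2 = lam 2" and "lN = lam CARD('N)"
    and "\<gamma> > 0"
    and "D1 ** transpose E = 0" and "transpose D2 ** C2 = 0"
    and "D1 ** transpose D1 = mat 1" and "transpose D2 ** D2 = mat 1"
    and "pos_def Q"
    and "neg_def (A ** Q + Q ** transpose A - Q ** transpose C1 ** C1 ** Q + E ** transpose E)"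
    and "0 < c" and "c < 2 / lN\<^sup>2"
  shows
    "let ineq = (\<lambda>l P. neg_def (transpose A ** P + P ** A
                  + (c\<^sup>2 * l ^ 3 - 2 * c * l) *\<^sub>R (P ** B ** transpose B ** P)
                  + lN *\<^sub>R (transpose C2 ** C2)));
         small = (\<lambda>P. trace (C1 ** Q ** P ** Q ** transpose C1)
                     + lN * trace (C2 ** Q ** transpose C2) < \<gamma> / (real CARD('N) - 1));
         F = (\<lambda>P. (- c) *\<^sub>R (transpose B ** P));
         G = Q ** transpose C1;
         good = (\<lambda>P. synchronizes Adj A B E C1 D1 (F P) G \<and>
                     H2_cost Adj e A B E C1 D1 C2 D2 (F P) G < ennreal \<gamma>)
     in (2 / (l2\<^sup>2 + l2 * lN + lN\<^sup>2) \<le> c \<longrightarrow>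
           (\<exists>P. pos_def P \<and> ineq lN P) \<and>
           (\<forall>P. pos_def P \<and> ineq lN P \<and> small P \<longrightarrow> good P)) \<and>
        (c < 2 / (l2\<^sup>2 + l2 * lN + lN\<^sup>2) \<longrightarrow>
           (\<exists>P. pos_def P \<and> ineq l2 P) \<and>
           (\<forall>P. pos_def P \<and> ineq l2 P \<and> small P \<longrightarrow> good P))"
proof -
  note card = assms(1) and stab = assms(2) and g = assms(4) and conn = assms(5) and e = assms(6)
    and lam = assms(7) and c = assms(17,18)
  obtain v :: "'N \<Rightarrow> real^'N" and \<mu> i0
    where v: "\<And>i j. v i \<bullet> v j = (if i = j then 1 else 0)"
      and ev: "\<And>i. laplacian Adj *v v i = \<mu> i *\<^sub>R v i"
      and i0: "\<mu> i0 = 0" and const: "\<And>j k. v i0 $ j = v i0 $ k"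
      and \<mu>: "\<And>i. i \<noteq> i0 \<Longrightarrow> l2 \<le> \<mu> i" "\<And>i. i \<noteq> i0 \<Longrightarrow> \<mu> i \<le> lN" and l2: "0 < l2"
    using laplacian_spectrum[OF g conn lam card] unfolding assms(8,9) by metis
  have "l2 \<le> lN"
    using lam card unfolding ordered_eigenvalues_def assms(8,9) by (auto elim!: mono_onD)
  then have lN: "0 < lN"
    using l2 by simp
  have pos: "0 < \<mu> i" if "i \<noteq> i0" for i
    using \<mu>(1)[OF that] l2 by simp
  \<comment> \<open>The open premise bounds the coefficients of the modes; \<open>upper\<close> or
    \<open>lower\<close> settles it once the case has fixed \<open>\<kappa>\<close>.\<close>
  note good = protocol_synchronizes_and_suboptimal[OF card assms(10) g e v ev i0 const pos \<mu>(2) _ assms(11-16)]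
  have upper: "c\<^sup>2 * \<mu> i ^ 3 - 2 * c * \<mu> i \<le> c\<^sup>2 * lN ^ 3 - 2 * c * lN"
    if "2 / (l2\<^sup>2 + l2 * lN + lN\<^sup>2) \<le> c" "i \<noteq> i0" for i
    by (rule cubic_le_at_upper_end[OF l2 \<mu>(1) \<mu>(2) c(1)]) (use that in auto)
  have lower: "c\<^sup>2 * \<mu> i ^ 3 - 2 * c * \<mu> i \<le> c\<^sup>2 * l2 ^ 3 - 2 * c * l2"
    if "c < 2 / (l2\<^sup>2 + l2 * lN + lN\<^sup>2)" "i \<noteq> i0" for i
    by (rule cubic_le_at_lower_end[OF l2 \<mu>(1) \<mu>(2) c(1)]) (use that in auto)
  \<comment> \<open>The negativity of the cubic is available at both \<open>lN\<close> and
    \<open>l2\<close>, each at most \<open>lN\<close>, so both existence claims follow.\<close>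
  note solvable = riccati_inequality_solvable[OF stab cubic_negative[OF _ _ c] less_imp_le[OF lN]]
  show ?thesis
    unfolding Let_def
    by (intro conjI allI impI solvable lN l2 order_refl \<open>l2 \<le> lN\<close>;
      elim conjE; rule good; (assumption | erule (1) upper | erule (1) lower))
qed

end
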